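(* Let $G$ be a finite group acting on $\mathbb{R}^n$ by a linear representation $\vartheta:G\to GL(\mathbb{R}^n)$, and let $f\in\mathbb{R}[\mathbf{x}]=\mathbb{R}[x_1,\dots,x_n]$ be a sum of squares polynomial that is invariant under the action of $G$. Let $\theta_1,\dots,\theta_n$ and $\eta_1,\dots,\eta_t$ be primary and secondary invariants of the invariant ring $\mathbb{R}[\mathbf{x}]^G$, and let $\tilde f(\theta,\eta)$ be the representation of $f$ in terms of these invariants. Then $\tilde f$ has a representation of the form $$\tilde f(\theta,\eta)=\sum_{i=1}^h\bigl\langle S_i(\theta),\Pi_i(\theta,\eta)\bigr\rangle,$$ where the matrices $\Pi_i\in\mathbb{R}[\theta,\eta]^{r_i\times r_i}$ (defined in the context) depend only on the group action, and the $S_i\in\mathbb{R}[\theta]^{r_i\times r_i}$ are sum of squares (SOS) matrices.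
   Context: Invariance of $f$ means $f(\mathbf{x})=f(\vartheta(g)\mathbf{x})$ for all $g\in G$; $\mathbb{R}[\mathbf{x}]^G$ is the ring of invariant polynomials. For real matrices (or matrices with polynomial entries) $A,B$ of the same size, $\langle A,B\rangle=\sum_{k,l}A_{kl}B_{kl}$. A polynomial is a sum of squares if it is a finite sum $\sum_k p_k^2$ of squares of real polynomials. SOS matrix: a symmetric matrix $S\in\mathbb{R}[\theta]^{m\times m}$ is a sum of squares (SOS) matrix if, with new indeterminates $\mathbf{y}=(y_1,\dots,y_m)$, the scalar polynomial $\mathbf{y}^TS\mathbf{y}$ is a sum of squares in $\mathbb{R}[\theta,\mathbf{y}]$ (with $\theta=(\theta_1,\dots,\theta_n)$ regarded as indeterminates). Primary and secondary invariants: homogeneous invariants $\theta_1(\mathbf{x}),\dots,\theta_n(\mathbf{x})$ (primary, algebraically independent) and $\eta_1(\mathbf{x}),\dots,\eta_t(\mathbf{x})$ (secondary) giving a Hironaka decomposition $\mathbb{R}[\mathbf{x}]^G=\bigoplus_{j=1}^t\eta_j(\mathbf{x})\,\mathbb{R}[\theta_1(\mathbf{x}),\dots,\theta_n(\mathbf{x})]$. Every invariant polynomial $r$ has a unique representation $\tilde r(\theta,\eta)=\sum_{j=1}^t\eta_j\tilde r_j(\theta)$, linear in $\eta$, with $r(\mathbf{x})=\tilde r(\theta(\mathbf{x}),\eta(\mathbf{x}))$. The matrices $\Pi_i$: let $\vartheta_1,\dots,\vartheta_h$ be the real irreducible representations of $G$ up to equivalence, of dimensions $n_1,\dots,n_h$,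 each given by orthogonal matrices. A $\vartheta$-$\vartheta_i$-equivariant is a polynomial map $b:\mathbb{R}^n\to\mathbb{R}^{n_i}$ with $b(\vartheta(g)\mathbf{x})=\vartheta_i(g)b(\mathbf{x})$ for all $g\in G$. The module $M_i$ of all $\vartheta$-$\vartheta_i$-equivariants is a free module of finite rank $r_i$ over the ring $\mathbb{R}[\theta]$ of polynomials in the primary invariants; fix a (homogeneous) basis $b^i_1,\dots,b^i_{r_i}\in\mathbb{R}[\mathbf{x}]^{n_i}$. The $(k,l)$ entry of $\Pi_i(\theta,\eta)$ is the representation, in terms of primary and secondary invariants (linear in $\eta$), of the invariant polynomial $\bigl(b^i_k(\mathbf{x})\bigr)^Tb^i_l(\mathbf{x})$. *)

theory Defs
  imports "HOL-Library.Poly_Mapping" "Jordan_Normal_Form.VS_Connect"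
begin

text \<open>
  Real polynomials in variables of type \<open>'v\<close>, as finitely supported maps from monomials
  (exponent vectors) to coefficients; the ring operations are those of the library.
  The ring over a given set \<open>V\<close> of variables is cut out by \<open>polys_in V\<close>:
  \<open>\<real>[x\<^sub>1,\<dots>,x\<^sub>n]\<close> and \<open>\<real>[\<theta>\<^sub>1,\<dots>,\<theta>\<^sub>n]\<close> are both rendered as \<open>polys_in {..<n}\<close> over \<open>nat\<close>
  (indices start at 0), and rings in two groups of variables, \<open>\<real>[\<theta>,\<eta>]\<close> and \<open>\<real>[\<theta>,y]\<close>, live over
  \<open>nat + nat\<close>, with \<open>Inl i\<close> standing for \<open>\<theta>\<^sub>i\<close> and \<open>Inr j\<close> for \<open>\<eta>\<^sub>j\<close> or \<open>y\<^sub>j\<close>.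
\<close>

type_synonym 'v rpoly = "('v \<Rightarrow>\<^sub>0 nat) \<Rightarrow>\<^sub>0 real"

definition const_poly :: "real \<Rightarrow> 'v rpoly" where
  "const_poly c = Poly_Mapping.single 0 c"

definition var_poly :: "'v \<Rightarrow> 'v rpoly" where
  "var_poly v = Poly_Mapping.single (Poly_Mapping.single v 1) 1"

definition polys_in :: "'v set \<Rightarrow> 'v rpoly set" where
  "polys_in V = {p. \<forall>m \<in> Poly_Mapping.keys p. Poly_Mapping.keys m \<subseteq> V}"

definition poly_subst :: "('v \<Rightarrow> 'w rpoly) \<Rightarrow> 'v rpoly \<Rightarrow> 'w rpoly" where
  "poly_subst \<sigma> p =
     (\<Sum>m \<in> Poly_Mapping.keys p. const_poly (Poly_Mapping.lookup p m) *
        (\<Prod>v \<in> Poly_Mapping.keys m. \<sigma> v ^ Poly_Mapping.lookup m v))"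

text \<open>The inclusion of \<open>\<real>[\<theta>]\<close> into \<open>\<real>[\<theta>,\<eta>]\<close> or \<open>\<real>[\<theta>,y]\<close>.\<close>

definition incl_poly :: "nat rpoly \<Rightarrow> (nat + nat) rpoly" where
  "incl_poly = poly_subst (\<lambda>i. var_poly (Inl i))"

text \<open>The zero polynomial is homogeneous of every degree.\<close>

definition homogeneous_of :: "nat \<Rightarrow> 'v rpoly \<Rightarrow> bool" where
  "homogeneous_of e p \<longleftrightarrow>
     (\<forall>m \<in> Poly_Mapping.keys p. (\<Sum>v \<in> Poly_Mapping.keys m. Poly_Mapping.lookup m v) = e)"

definition sos_in :: "'v set \<Rightarrow> 'v rpoly \<Rightarrow> bool" where
  "sos_in V p \<longleftrightarrow> (\<exists>qs. set qs \<subseteq> polys_in V \<and> p = (\<Sum>q\<leftarrow>qs. q ^ 2))"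

definition sos_matrix :: "nat \<Rightarrow> nat \<Rightarrow> nat rpoly mat \<Rightarrow> bool" where
  "sos_matrix n m S \<longleftrightarrow>
     S \<in> carrier_mat m m \<and> elements_mat S \<subseteq> polys_in {..<n} \<and> transpose_mat S = S \<and>
     (let y = vec m (\<lambda>k. var_poly (Inr k))
      in sos_in ({..<n} <+> {..<m}) (y \<bullet> (map_mat incl_poly S *\<^sub>v y)))"

definition mat_inner :: "'a::semiring_0 mat \<Rightarrow> 'a mat \<Rightarrow> 'a" where
  "mat_inner A B = (\<Sum>k<dim_row A. \<Sum>l<dim_col A. A $$ (k,l) * B $$ (k,l))"


subsection \<open>Representations\<close>

definition GL_real :: "nat \<Rightarrow> real mat monoid" where
  "GL_real d = units_of (ring_mat TYPE(real) d ())"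

abbreviation real_rep :: "('g, 'b) monoid_scheme \<Rightarrow> nat \<Rightarrow> ('g \<Rightarrow> real mat) \<Rightarrow> bool" where
  "real_rep G d \<rho> \<equiv> \<rho> \<in> hom G (GL_real d)"

definition irreducible_rep :: "('g, 'b) monoid_scheme \<Rightarrow> nat \<Rightarrow> ('g \<Rightarrow> real mat) \<Rightarrow> bool" where
  "irreducible_rep G d \<rho> \<longleftrightarrow>
     real_rep G d \<rho> \<and> d > 0 \<and>
     (\<forall>W. VectorSpace.subspace class_ring W (module_vec TYPE(real) d) \<and>
          (\<forall>g \<in> carrier G. \<forall>w \<in> W. \<rho> g *\<^sub>v w \<in> W)
          \<longrightarrow> W = {0\<^sub>v d} \<or> W = carrier_vec d)"

definition equivalent_reps ::
  "('g, 'b) monoid_scheme \<Rightarrow> nat \<Rightarrow> ('g \<Rightarrow> real mat) \<Rightarrow> nat \<Rightarrow> ('g \<Rightarrow> real mat) \<Rightarrow> bool" where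
  "equivalent_reps G d \<rho> e \<sigma> \<longleftrightarrow>
     d = e \<and> (\<exists>T \<in> carrier (GL_real d). \<forall>g \<in> carrier G. T * \<rho> g = \<sigma> g * T)"

text \<open>
  \<open>(d i, \<rho> i)\<close> for \<open>i < h\<close> lists the real irreducible representations of \<open>G\<close>, one for each
  equivalence class, all given by orthogonal matrices.
\<close>

definition orthogonal_irreps ::
  "('g, 'b) monoid_scheme \<Rightarrow> nat \<Rightarrow> (nat \<Rightarrow> nat) \<Rightarrow> (nat \<Rightarrow> 'g \<Rightarrow> real mat) \<Rightarrow> bool" where
  "orthogonal_irreps G h d \<rho> \<longleftrightarrow>
     (\<forall>i<h. irreducible_rep G (d i) (\<rho> i) \<and>
            (\<forall>g \<in> carrier G. transpose_mat (\<rho> i g) * \<rho> i g = 1\<^sub>m (d i))) \<and>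
     (\<forall>i<h. \<forall>j<h. i \<noteq> j \<longrightarrow> \<not> equivalent_reps G (d i) (\<rho> i) (d j) (\<rho> j)) \<and>
     (\<forall>e \<sigma>. irreducible_rep G e \<sigma> \<longrightarrow> (\<exists>i<h. equivalent_reps G e \<sigma> (d i) (\<rho> i)))"


subsection \<open>Invariants\<close>

text \<open>The polynomial \<open>p(A x)\<close>.\<close>

definition lin_subst :: "real mat \<Rightarrow> nat rpoly \<Rightarrow> nat rpoly" where
  "lin_subst A = poly_subst (\<lambda>k. \<Sum>l<dim_col A. const_poly (A $$ (k,l)) * var_poly l)"

definition invariants ::
  "('g, 'b) monoid_scheme \<Rightarrow> nat \<Rightarrow> ('g \<Rightarrow> real mat) \<Rightarrow> nat rpoly set" where
  "invariants G n \<phi> =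
     {p \<in> polys_in {..<n}. \<forall>g \<in> carrier G. p = lin_subst (\<phi> g) p}"

definition alg_independent :: "nat \<Rightarrow> (nat \<Rightarrow> nat rpoly) \<Rightarrow> bool" where
  "alg_independent n \<theta> \<longleftrightarrow> (\<forall>p \<in> polys_in {..<n}. poly_subst \<theta> p = 0 \<longrightarrow> p = 0)"

text \<open>
  The last two conjuncts are the Hironaka decomposition: \<open>\<real>[x]\<^sup>G\<close> is the direct sum of the
  \<open>\<eta>\<^sub>j \<real>[\<theta>\<^sub>1(x),\<dots>,\<theta>\<^sub>n(x)]\<close>, the coefficients of an invariant in \<open>\<real>[\<theta>]\<close> being unique.
\<close>

definition primary_secondary_invariants ::
  "('g, 'b) monoid_scheme \<Rightarrow> nat \<Rightarrow> ('g \<Rightarrow> real mat) \<Rightarrow> (nat \<Rightarrow> nat rpoly) \<Rightarrow>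
     nat \<Rightarrow> (nat \<Rightarrow> nat rpoly) \<Rightarrow> bool" where
  "primary_secondary_invariants G n \<phi> \<theta> t \<eta> \<longleftrightarrow>
     (\<forall>i<n. \<theta> i \<in> invariants G n \<phi> \<and> (\<exists>e. homogeneous_of e (\<theta> i))) \<and>
     alg_independent n \<theta> \<and>
     (\<forall>j<t. \<eta> j \<in> invariants G n \<phi> \<and> (\<exists>e. homogeneous_of e (\<eta> j))) \<and>
     invariants G n \<phi> =
       {\<Sum>j<t. \<eta> j * poly_subst \<theta> (c j) | c. \<forall>j<t. c j \<in> polys_in {..<n}} \<and>
     (\<forall>c. (\<forall>j<t. c j \<in> polys_in {..<n}) \<and> (\<Sum>j<t. \<eta> j * poly_subst \<theta> (c j)) = 0
          \<longrightarrow> (\<forall>j<t. c j = 0))"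

text \<open>
  The representation of an invariant \<open>r\<close> in terms of the primary and secondary invariants: the
  unique polynomial \<open>\<Sum>\<^sub>j \<eta>\<^sub>j c\<^sub>j(\<theta>)\<close> in the indeterminates \<open>\<theta>\<close>, \<open>\<eta>\<close> that becomes
  \<open>r\<close> on substituting \<open>\<theta>(x)\<close>, \<open>\<eta>(x)\<close>.
\<close>

definition inv_representation ::
  "nat \<Rightarrow> (nat \<Rightarrow> nat rpoly) \<Rightarrow> nat \<Rightarrow> (nat \<Rightarrow> nat rpoly) \<Rightarrow> nat rpoly \<Rightarrow> (nat + nat) rpoly" where
  "inv_representation n \<theta> t \<eta> r =
     (THE R. (\<exists>c. (\<forall>j<t. c j \<in> polys_in {..<n}) \<and>
                  R = (\<Sum>j<t. var_poly (Inr j) * incl_poly (c j))) \<and>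
             r = poly_subst (case_sum \<theta> \<eta>) R)"


subsection \<open>Equivariants\<close>

definition equivariants ::
  "('g, 'b) monoid_scheme \<Rightarrow> nat \<Rightarrow> ('g \<Rightarrow> real mat) \<Rightarrow> nat \<Rightarrow> ('g \<Rightarrow> real mat) \<Rightarrow>
     nat rpoly vec set" where
  "equivariants G n \<phi> d \<rho> =
     {b \<in> carrier_vec d. (\<forall>a<d. b $ a \<in> polys_in {..<n}) \<and>
        (\<forall>g \<in> carrier G. map_vec (lin_subst (\<phi> g)) b = map_mat const_poly (\<rho> g) *\<^sub>v b)}"

text \<open>The element \<open>\<Sum>\<^sub>k c\<^sub>k(\<theta>(x)) b\<^sub>k(x)\<close> of the module \<open>\<real>[x]\<^sup>d\<close> over \<open>\<real>[\<theta>]\<close>.\<close>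

definition theta_comb ::
  "(nat \<Rightarrow> nat rpoly) \<Rightarrow> nat \<Rightarrow> nat \<Rightarrow> (nat \<Rightarrow> nat rpoly vec) \<Rightarrow> (nat \<Rightarrow> nat rpoly) \<Rightarrow>
     nat rpoly vec" where
  "theta_comb \<theta> d r b c = vec d (\<lambda>a. \<Sum>k<r. poly_subst \<theta> (c k) * b k $ a)"

text \<open>\<open>b\<^sub>0,\<dots>,b\<^bsub>r-1\<^esub>\<close> is a homogeneous basis of the module of equivariants over \<open>\<real>[\<theta>]\<close>.\<close>

definition equivariant_basis ::
  "('g, 'b) monoid_scheme \<Rightarrow> nat \<Rightarrow> ('g \<Rightarrow> real mat) \<Rightarrow> (nat \<Rightarrow> nat rpoly) \<Rightarrow>
     nat \<Rightarrow> ('g \<Rightarrow> real mat) \<Rightarrow> nat \<Rightarrow> (nat \<Rightarrow> nat rpoly vec) \<Rightarrow> bool" where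
  "equivariant_basis G n \<phi> \<theta> d \<rho> r b \<longleftrightarrow>
     (\<forall>k<r. b k \<in> equivariants G n \<phi> d \<rho> \<and> (\<exists>e. \<forall>a<d. homogeneous_of e (b k $ a))) \<and>
     equivariants G n \<phi> d \<rho> =
       {theta_comb \<theta> d r b c | c. \<forall>k<r. c k \<in> polys_in {..<n}} \<and>
     (\<forall>c. (\<forall>k<r. c k \<in> polys_in {..<n}) \<and> theta_comb \<theta> d r b c = 0\<^sub>v d
          \<longrightarrow> (\<forall>k<r. c k = 0))"

definition Pi_mat ::
  "nat \<Rightarrow> (nat \<Rightarrow> nat rpoly) \<Rightarrow> nat \<Rightarrow> (nat \<Rightarrow> nat rpoly) \<Rightarrow>
     nat \<Rightarrow> (nat \<Rightarrow> nat rpoly vec) \<Rightarrow> (nat + nat) rpoly mat" where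
  "Pi_mat n \<theta> t \<eta> r b = mat r r (\<lambda>(k,l). inv_representation n \<theta> t \<eta> (b k \<bullet> b l))"

end

theory Submission
  imports Defs "Jordan_Normal_Form.Spectral_Radius"
begin

text \<open>
  Averaging the squares \<open>q\<^sup>2\<close> of a sum of squares representation of \<open>f\<close> over \<open>G\<close> replaces each of them by
  \<open>1/|G| * \<Sum>\<^sub>g (q \<circ> \<phi> g)\<^sup>2\<close>, which is the squared Euclidean norm of a vector of polynomials, namely the
  vector of all translates of \<open>q\<close>, up to a constant. This vector is an equivariant for the regular
  representation of \<open>G\<close>.

  The regular representation is orthogonal. Hence it is an orthogonal direct sum of irreducible
  representations, and each of these is equivalent to one of the \<open>\<rho> i\<close> by an orthogonal matrix. In terms of
  matrices: there are finitely many intertwiners \<open>T\<close> from the regular representation to the \<open>\<rho> i\<close> with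
  \<open>\<Sum> T\<^sup>T * T = 1\<close> (\<open>parseval_frame_exists\<close>). Applied to the vector of translates, every such \<open>T\<close> gives an
  equivariant for \<open>\<rho> i\<close>, and the squared norms add up. So \<open>f\<close> is a sum of squared norms \<open>u \<bullet> u\<close> of equivariants
  \<open>u\<close> for the \<open>\<rho> i\<close> (\<open>invariant_sos_as_equivariant_norms\<close>).

  Now expand \<open>u = \<Sum>\<^sub>k c\<^sub>k(\<theta>) b\<^sub>k\<close> in the given basis of equivariants. Then
  \<open>u \<bullet> u = \<Sum>\<^sub>k \<Sum>\<^sub>l c\<^sub>k(\<theta>) c\<^sub>l(\<theta>) (b\<^sub>k \<bullet> b\<^sub>l)\<close>, which is the inner product of the matrix \<open>c * c\<^sup>T\<close> with
  \<open>\<Pi>\<^sub>i\<close>. Let \<open>S\<^sub>i\<close> be the sum of these matrices over all \<open>u\<close> that belong to \<open>\<rho> i\<close>; it is a sum of squares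
  matrix because \<open>y\<^sup>T c c\<^sup>T y = (\<Sum>\<^sub>k c\<^sub>k y\<^sub>k)\<^sup>2\<close> (\<open>sos_matrix_gram\<close>). The resulting identity is one between
  polynomials in \<open>x\<close>; it lifts to the indeterminates \<open>\<theta>\<close>, \<open>\<eta>\<close> because both sides are linear in \<open>\<eta>\<close> and
  such representations of an invariant are unique (\<open>represents_unique\<close>).
\<close>

section \<open>Substitution in polynomials\<close>

definition monom_subst :: "('v \<Rightarrow> 'w rpoly) \<Rightarrow> ('v \<Rightarrow>\<^sub>0 nat) \<Rightarrow> 'w rpoly" where
  "monom_subst \<sigma> m = (\<Prod>v \<in> Poly_Mapping.keys m. \<sigma> v ^ Poly_Mapping.lookup m v)"

lemma monom_subst_superset:
  assumes "finite V" "Poly_Mapping.keys m \<subseteq> V"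
  shows "monom_subst \<sigma> m = (\<Prod>v \<in> V. \<sigma> v ^ Poly_Mapping.lookup m v)"
  unfolding monom_subst_def
  by (rule prod.mono_neutral_left) (use assms in \<open>auto simp: in_keys_iff\<close>)

lemma monom_subst_add: "monom_subst \<sigma> (m + m') = monom_subst \<sigma> m * monom_subst \<sigma> m'"
proof -
  let ?V = "Poly_Mapping.keys m \<union> Poly_Mapping.keys m'"
  have "monom_subst \<sigma> (m + m') = (\<Prod>v \<in> ?V. \<sigma> v ^ Poly_Mapping.lookup (m + m') v)"
    using keys_add[of m m'] by (intro monom_subst_superset) auto
  also have "\<dots> = monom_subst \<sigma> m * monom_subst \<sigma> m'"
    by (subst (1 2) monom_subst_superset[of ?V]) (auto simp: lookup_add power_add prod.distrib)
  finally show ?thesis .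
qed

lemma const_poly_hom:
  "const_poly 0 = 0" "const_poly 1 = 1"
  "const_poly (c + c') = const_poly c + const_poly c'"
  "const_poly (c * c') = const_poly c * const_poly c'"
  by (auto simp: const_poly_def single_add mult_single)

lemma poly_subst_superset:
  assumes "finite M" "Poly_Mapping.keys p \<subseteq> M"
  shows "poly_subst \<sigma> p = (\<Sum>m \<in> M. const_poly (Poly_Mapping.lookup p m) * monom_subst \<sigma> m)"
  unfolding poly_subst_def monom_subst_def[symmetric]
  by (rule sum.mono_neutral_left) (use assms in \<open>auto simp: in_keys_iff const_poly_hom\<close>)

lemma poly_subst_add: "poly_subst \<sigma> (p + q) = poly_subst \<sigma> p + poly_subst \<sigma> q"
proof -
  let ?M = "Poly_Mapping.keys p \<union> Poly_Mapping.keys q"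
  have "poly_subst \<sigma> (p + q)
      = (\<Sum>m \<in> ?M. const_poly (Poly_Mapping.lookup (p + q) m) * monom_subst \<sigma> m)"
    using keys_add[of p q] by (intro poly_subst_superset) auto
  also have "\<dots> = poly_subst \<sigma> p + poly_subst \<sigma> q"
    by (subst (1 2) poly_subst_superset[of ?M])
       (auto simp: lookup_add const_poly_hom algebra_simps sum.distrib)
  finally show ?thesis .
qed

lemma poly_subst_single: "poly_subst \<sigma> (Poly_Mapping.single m c) = const_poly c * monom_subst \<sigma> m"
  by (subst poly_subst_superset[of "{m}"]) auto

lemma poly_subst_0 [simp]: "poly_subst \<sigma> 0 = 0"
  by (simp add: poly_subst_def)

lemma poly_subst_const [simp]: "poly_subst \<sigma> (const_poly c) = const_poly c"
  unfolding const_poly_def by (subst poly_subst_single) (simp add: monom_subst_def const_poly_def)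

lemma poly_subst_1 [simp]: "poly_subst \<sigma> 1 = 1"
  using poly_subst_const[of \<sigma> 1] by (simp add: const_poly_hom)

lemma poly_subst_var [simp]: "poly_subst \<sigma> (var_poly v) = \<sigma> v"
  unfolding var_poly_def by (subst poly_subst_single) (simp add: monom_subst_def const_poly_hom)

text \<open>
  Every polynomial is a sum of terms, so identities that are additive in \<open>p\<close> need to be checked
  on single terms only.
\<close>

lemma rpoly_induct [case_names single add]:
  assumes "\<And>m c. P (Poly_Mapping.single m c)" "\<And>p q. P p \<Longrightarrow> P q \<Longrightarrow> P (p + q)"
  shows "P (p :: 'v rpoly)"
proof (induction p rule: update_induct)
  case const
  show ?case using assms(1)[of 0 0] by simp
next
  case (update f a b)
  have "Poly_Mapping.update a b f = f + Poly_Mapping.single a b"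
    using update(1) by (intro poly_mapping_eqI)
       (auto simp: lookup_update lookup_add lookup_single in_keys_iff when_def)
  then show ?case using update assms by metis
qed

lemma poly_subst_mult: "poly_subst \<sigma> (p * q) = poly_subst \<sigma> p * poly_subst \<sigma> q"
proof (induction p rule: rpoly_induct)
  case (single m c)
  show ?case
  proof (induction q rule: rpoly_induct)
    case (single m' c')
    then show ?case
      by (simp add: mult_single poly_subst_single monom_subst_add const_poly_hom algebra_simps)
  qed (simp add: poly_subst_add algebra_simps)
qed (simp add: poly_subst_add algebra_simps)

interpretation poly_subst: comm_ring_hom "poly_subst \<sigma>" for \<sigma> :: "'v \<Rightarrow> 'w rpoly"
  by unfold_locales (auto simp: poly_subst_add poly_subst_mult)

interpretation const_poly: comm_ring_hom "const_poly :: real \<Rightarrow> 'v rpoly"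
  by unfold_locales (auto simp: const_poly_hom)

lemma const_poly_sum_list: "const_poly (\<Sum>x\<leftarrow>xs. c x) = (\<Sum>x\<leftarrow>xs. const_poly (c x))"
  by (induction xs) (auto simp: const_poly_hom)

lemma poly_subst_subst:
  "poly_subst \<tau> (poly_subst \<sigma> p) = poly_subst (\<lambda>v. poly_subst \<tau> (\<sigma> v)) p"
  unfolding poly_subst_def[of \<sigma>] poly_subst_def[of "\<lambda>v. poly_subst \<tau> (\<sigma> v)"]
  by (simp add: poly_subst.hom_sum poly_subst_mult poly_subst.hom_prod poly_subst.hom_power)

lemma poly_subst_cong:
  assumes "p \<in> polys_in V" "\<And>v. v \<in> V \<Longrightarrow> \<sigma> v = \<tau> v"
  shows "poly_subst \<sigma> p = poly_subst \<tau> p"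
  unfolding poly_subst_def
proof (intro sum.cong prod.cong refl arg_cong2[of _ _ _ _ "(*)"])
  fix m v assume "m \<in> Poly_Mapping.keys p" "v \<in> Poly_Mapping.keys m"
  then have "v \<in> V" using assms(1) by (auto simp: polys_in_def)
  then show "\<sigma> v ^ Poly_Mapping.lookup m v = \<tau> v ^ Poly_Mapping.lookup m v" using assms(2) by simp
qed

lemma polys_in_0 [simp]: "0 \<in> polys_in V" by (simp add: polys_in_def)

lemma polys_in_const [simp]: "const_poly c \<in> polys_in V"
  by (simp add: polys_in_def const_poly_def)

lemma polys_in_1 [simp]: "1 \<in> polys_in V"
  using polys_in_const[of 1 V] by (simp add: const_poly_hom)

lemma polys_in_var [simp]: "var_poly v \<in> polys_in V \<longleftrightarrow> v \<in> V"
  by (simp add: polys_in_def var_poly_def)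

lemma polys_in_add [intro]: "p \<in> polys_in V \<Longrightarrow> q \<in> polys_in V \<Longrightarrow> p + q \<in> polys_in V"
  using keys_add[of p q] by (fastforce simp: polys_in_def)

lemma polys_in_mult [intro]:
  assumes "p \<in> polys_in V" "q \<in> polys_in V" shows "p * q \<in> polys_in V"
  unfolding polys_in_def
proof safe
  fix m v assume "m \<in> Poly_Mapping.keys (p * q)" "v \<in> Poly_Mapping.keys m"
  then obtain a c where "m = a + c" "a \<in> Poly_Mapping.keys p" "c \<in> Poly_Mapping.keys q"
    using keys_mult[of p q] by auto
  with \<open>v \<in> _\<close> show "v \<in> V" using keys_add[of a c] assms by (force simp: polys_in_def)
qed

lemma polys_in_sum [intro]: "(\<And>x. x \<in> A \<Longrightarrow> p x \<in> polys_in V) \<Longrightarrow> (\<Sum>x\<in>A. p x) \<in> polys_in V"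
  by (induction A rule: infinite_finite_induct) auto

lemma polys_in_sum_list: "(\<And>x. x \<in> set xs \<Longrightarrow> p x \<in> polys_in V) \<Longrightarrow> (\<Sum>x\<leftarrow>xs. p x) \<in> polys_in V"
  by (induction xs) auto

lemma polys_in_diff [intro]: "p \<in> polys_in V \<Longrightarrow> q \<in> polys_in V \<Longrightarrow> p - q \<in> polys_in V"
  using keys_diff[of p q] by (fastforce simp: polys_in_def)

lemma polys_in_prod [intro]: "(\<And>x. x \<in> A \<Longrightarrow> p x \<in> polys_in V) \<Longrightarrow> (\<Prod>x\<in>A. p x) \<in> polys_in V"
  by (induction A rule: infinite_finite_induct) auto

lemma polys_in_power [intro]: "p \<in> polys_in V \<Longrightarrow> p ^ k \<in> polys_in V"
  by (induction k) auto

lemma polys_in_poly_subst: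
  assumes "p \<in> polys_in V" "\<And>v. v \<in> V \<Longrightarrow> \<sigma> v \<in> polys_in W"
  shows "poly_subst \<sigma> p \<in> polys_in W"
  unfolding poly_subst_def
proof (intro polys_in_sum polys_in_mult polys_in_prod polys_in_power polys_in_const)
  fix m v assume "m \<in> Poly_Mapping.keys p" "v \<in> Poly_Mapping.keys m"
  then have "v \<in> V" using assms(1) by (auto simp: polys_in_def)
  then show "\<sigma> v \<in> polys_in W" by (rule assms(2))
qed

lemma lin_subst_polys_in:
  assumes "p \<in> polys_in {..<n}" "A \<in> carrier_mat n n"
  shows "lin_subst A p \<in> polys_in {..<n}"
  unfolding lin_subst_def using assms by (intro polys_in_poly_subst polys_in_sum polys_in_mult) auto

text \<open>
  The order of the factors is reversed: substituting \<open>B x\<close> and then \<open>A x\<close> for the variables gives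
  \<open>p(B(A x))\<close>. The variables of \<open>p\<close> must be among the first \<open>n\<close> because the entries of \<open>A\<close> and
  \<open>B\<close> outside their dimensions have unspecified values.
\<close>

lemma lin_subst_lin_subst:
  assumes p: "p \<in> polys_in {..<n}" and A: "A \<in> carrier_mat n n" and B: "B \<in> carrier_mat n n"
  shows "lin_subst A (lin_subst B p) = lin_subst (B * A) p"
  unfolding lin_subst_def poly_subst_subst
proof (rule poly_subst_cong[OF p])
  fix k assume k: "k \<in> {..<n}"
  have "poly_subst (\<lambda>k. \<Sum>l<dim_col A. const_poly (A $$ (k, l)) * var_poly l)
           (\<Sum>j<dim_col B. const_poly (B $$ (k, j)) * var_poly j)
      = (\<Sum>j<n. \<Sum>l<n. const_poly (B $$ (k, j) * A $$ (j, l)) * var_poly l)"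
    using A B
    by (simp add: poly_subst.hom_sum poly_subst_mult const_poly_hom sum_distrib_left mult.assoc)
  also have "\<dots> = (\<Sum>l<n. \<Sum>j<n. const_poly (B $$ (k, j) * A $$ (j, l)) * var_poly l)"
    by (rule sum.swap)
  also have "\<dots> = (\<Sum>l<dim_col (B * A). const_poly ((B * A) $$ (k, l)) * var_poly l)"
    using k A B
    by (simp add: scalar_prod_def const_poly.hom_sum sum_distrib_right lessThan_atLeast0)
  finally show "poly_subst (\<lambda>k. \<Sum>l<dim_col A. const_poly (A $$ (k, l)) * var_poly l)
           (\<Sum>l<dim_col B. const_poly (B $$ (k, l)) * var_poly l)
      = (\<Sum>l<dim_col (B * A). const_poly ((B * A) $$ (k, l)) * var_poly l)" .
qed

section \<open>Orthonormal systems and projections\<close>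

lemma scalar_prod_self_eq_0:
  fixes v :: "real vec" assumes "v \<bullet> v = 0" "v \<in> carrier_vec n" shows "v = 0\<^sub>v n"
proof -
  have "\<forall>i\<in>{0..<n}. v $ i * v $ i = 0"
    using assms by (subst sum_nonneg_eq_0_iff[symmetric]) (auto simp: scalar_prod_def)
  then show ?thesis using assms(2) by (intro eq_vecI) auto
qed

text \<open>
  Over the complex numbers \<open>A\<close> has an eigenvector \<open>w = x + i y\<close>. Comparing
  \<open>(A x) \<bullet> y\<close> with \<open>x \<bullet> (A y)\<close> gives \<open>Im z * (|x|\<^sup>2 + |y|\<^sup>2) = 0\<close> for its eigenvalue \<open>z\<close>,
  so \<open>z\<close> is real and \<open>x\<close> or \<open>y\<close>, whichever is nonzero, is a real eigenvector.
\<close>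

lemma symmetric_mat_eigenvector:
  fixes A :: "real mat"
  assumes A: "A \<in> carrier_mat n n" and sym: "transpose_mat A = A" and n: "n > 0"
  obtains c v where "v \<in> carrier_vec n" "v \<noteq> 0\<^sub>v n" "A *\<^sub>v v = c \<cdot>\<^sub>v v"
proof -
  let ?C = "map_mat complex_of_real A"
  have C: "?C \<in> carrier_mat n n" using A by simp
  obtain z where "eigenvalue ?C z" using spectrum_non_empty[OF C n] by (auto simp: spectrum_def)
  then obtain w where w: "w \<in> carrier_vec n" "w \<noteq> 0\<^sub>v n" "?C *\<^sub>v w = z \<cdot>\<^sub>v w"
    using A by (auto simp: eigenvalue_def eigenvector_def)
  define x where "x = map_vec Re w"
  define y where "y = map_vec Im w"
  have x: "x \<in> carrier_vec n" and y: "y \<in> carrier_vec n" using w(1) by (auto simp: x_def y_def)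
  have comp: "(\<Sum>j<n. complex_of_real (A $$ (i,j)) * w $ j) = z * w $ i" if "i < n" for i
  proof -
    have "(?C *\<^sub>v w) $ i = (z \<cdot>\<^sub>v w) $ i" using w(3) by simp
    then show ?thesis using that A w(1) by (simp add: scalar_prod_def lessThan_atLeast0)
  qed
  have Ax: "(A *\<^sub>v x) $ i = Re z * x $ i - Im z * y $ i" if "i < n" for i
    using arg_cong[OF comp[OF that], of Re] that A w(1)
    by (simp add: scalar_prod_def lessThan_atLeast0 x_def y_def Re_sum)
  have Ay: "(A *\<^sub>v y) $ i = Im z * x $ i + Re z * y $ i" if "i < n" for i
    using arg_cong[OF comp[OF that], of Im] that A w(1)
    by (simp add: scalar_prod_def lessThan_atLeast0 x_def y_def Im_sum)
  have "(A *\<^sub>v x) \<bullet> y = x \<bullet> (A *\<^sub>v y)"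
    using transpose_vec_mult_scalar[OF A y x] sym x y A
    by (metis comm_scalar_prod mult_mat_vec_carrier)
  then have "(\<Sum>i<n. (Re z * x $ i - Im z * y $ i) * y $ i)
      = (\<Sum>i<n. x $ i * (Im z * x $ i + Re z * y $ i))"
    using x y A Ax Ay by (simp add: scalar_prod_def lessThan_atLeast0 del: index_mult_mat_vec)
  then have "Im z * ((\<Sum>i<n. x $ i * x $ i) + (\<Sum>i<n. y $ i * y $ i)) = 0"
    by (simp add: algebra_simps sum.distrib sum_subtractf sum_distrib_left)
  moreover have "(\<Sum>i<n. x $ i * x $ i) = x \<bullet> x" "(\<Sum>i<n. y $ i * y $ i) = y \<bullet> y"
    using x y by (auto simp: scalar_prod_def lessThan_atLeast0)
  moreover have "x \<bullet> x \<ge> 0" "y \<bullet> y \<ge> 0" by (auto simp: scalar_prod_def intro: sum_nonneg)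
  moreover have ne: "x \<noteq> 0\<^sub>v n \<or> y \<noteq> 0\<^sub>v n"
  proof (rule ccontr)
    assume "\<not> ?thesis"
    then have "x $ i = 0" "y $ i = 0" if "i < n" for i using that by auto
    then have "w = 0\<^sub>v n" using w(1) by (intro eq_vecI) (auto simp: x_def y_def complex_eq_iff)
    with w(2) show False by simp
  qed
  ultimately have im: "Im z = 0"
    using scalar_prod_self_eq_0[OF _ x] scalar_prod_self_eq_0[OF _ y]
    by (metis add_nonneg_eq_0_iff mult_eq_0_iff)
  have "A *\<^sub>v x = Re z \<cdot>\<^sub>v x" "A *\<^sub>v y = Re z \<cdot>\<^sub>v y"
    using Ax Ay im x y A by (auto intro!: eq_vecI simp del: index_mult_mat_vec)
  then show thesis using ne x y that by blast
qed

text \<open>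
  The columns of \<open>B\<close> are orthonormal; then \<open>B * B\<^sup>T\<close> is the orthogonal projection onto their span.
  An orthonormal basis of a subspace is kept as such a matrix throughout.
\<close>

definition isometry_mat :: "nat \<Rightarrow> nat \<Rightarrow> real mat \<Rightarrow> bool" where
  "isometry_mat N k B \<longleftrightarrow> B \<in> carrier_mat N k \<and> transpose_mat B * B = 1\<^sub>m k"

text \<open>
  The trace of the projection is its rank. The identity counts dimensions: it bounds \<open>k\<close> by
  \<open>N\<close> and shows that the dimensions of complementary subspaces add up.
\<close>

lemma isometry_trace:
  assumes "isometry_mat N k B"
  shows "(\<Sum>j<N. (B * transpose_mat B) $$ (j,j)) = real k"
proof -
  have B: "B \<in> carrier_mat N k" using assms by (simp add: isometry_mat_def)
  have "(\<Sum>j<N. (B * transpose_mat B) $$ (j,j)) = (\<Sum>j<N. \<Sum>i<k. B $$ (j,i) * B $$ (j,i))"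
    using B by (simp add: scalar_prod_def lessThan_atLeast0)
  also have "\<dots> = (\<Sum>i<k. \<Sum>j<N. B $$ (j,i) * B $$ (j,i))" by (rule sum.swap)
  also have "\<dots> = (\<Sum>i<k. (transpose_mat B * B) $$ (i,i))"
    using B by (simp add: scalar_prod_def lessThan_atLeast0)
  also have "\<dots> = real k" using assms by (simp add: isometry_mat_def)
  finally show ?thesis .
qed

lemma isometry_proj:
  assumes "isometry_mat N k B"
  shows "(B * transpose_mat B) * B = B" "transpose_mat B * (B * transpose_mat B) = transpose_mat B"
proof -
  have B: "B \<in> carrier_mat N k" "transpose_mat B \<in> carrier_mat k N" "transpose_mat B * B = 1\<^sub>m k"
    using assms by (auto simp: isometry_mat_def)
  show "(B * transpose_mat B) * B = B" using B by (simp add: assoc_mult_mat[OF B(1,2,1)])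
  show "transpose_mat B * (B * transpose_mat B) = transpose_mat B"
    using B by (simp flip: assoc_mult_mat[OF B(2,1,2)])
qed

text \<open>
  A diagonal entry \<open>p\<close> of a symmetric idempotent matrix satisfies \<open>p\<^sup>2 \<le> p\<close>, hence \<open>p \<le> 1\<close>, so the
  trace \<open>k\<close> of the projection is at most \<open>N\<close>.
\<close>

lemma isometry_le:
  assumes iso: "isometry_mat N k B"
  shows "k \<le> N"
proof -
  define P where "P = B * transpose_mat B"
  have B: "B \<in> carrier_mat N k" "transpose_mat B \<in> carrier_mat k N" and P: "P \<in> carrier_mat N N"
    using iso by (auto simp: isometry_mat_def P_def)
  have sym: "transpose_mat P = P" using B by (simp add: P_def transpose_mult[OF B(1,2)])
  have idem: "P * P = P"
    using isometry_proj(1)[OF iso] P unfolding P_def[symmetric]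
    by (metis P_def B assoc_mult_mat)
  have le: "P $$ (j,j) \<le> 1" if j: "j < N" for j
  proof -
    have "P $$ (j,j) = (\<Sum>l<N. P $$ (j,l) * P $$ (l,j))"
      using arg_cong[OF idem, of "\<lambda>M. M $$ (j,j)"] j P
      by (simp add: scalar_prod_def lessThan_atLeast0)
    also have "\<dots> = (\<Sum>l<N. (P $$ (j,l))\<^sup>2)"
    proof (intro sum.cong refl)
      fix l assume "l \<in> {..<N}"
      then have "P $$ (l,j) = P $$ (j,l)"
        using arg_cong[OF sym, of "\<lambda>M. M $$ (j,l)"] j P
        by simp
      then show "P $$ (j,l) * P $$ (l,j) = (P $$ (j,l))\<^sup>2" by (simp add: power2_eq_square)
    qed
    finally have "(P $$ (j,j))\<^sup>2 \<le> P $$ (j,j)"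
      using member_le_sum[of j "{..<N}" "\<lambda>l. (P $$ (j,l))\<^sup>2"] j by simp
    then have "P $$ (j,j) * (P $$ (j,j) - 1) \<le> 0" by (simp add: power2_eq_square algebra_simps)
    then show ?thesis by (auto simp: mult_le_0_iff)
  qed
  have "real k = (\<Sum>j<N. P $$ (j,j))" using isometry_trace[OF iso] by (simp add: P_def)
  also have "\<dots> \<le> (\<Sum>j<N. 1)" by (rule sum_mono) (use le in auto)
  finally show ?thesis by simp
qed

lemma isometry_snoc:
  assumes iso: "isometry_mat N k B" and u: "u \<in> carrier_vec N" "u \<bullet> u = 1"
    "transpose_mat B *\<^sub>v u = 0\<^sub>v k"
  obtains B' where "isometry_mat N (Suc k) B'"
    "\<And>v. v \<in> carrier_vec (Suc k) \<Longrightarrow> B' *\<^sub>v v = B *\<^sub>v vec k (($) v) + v $ k \<cdot>\<^sub>v u"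
proof
  define B' where "B' = mat N (Suc k) (\<lambda>(j,i). if i < k then B $$ (j,i) else u $ j)"
  have B: "B \<in> carrier_mat N k" "transpose_mat B * B = 1\<^sub>m k"
    using iso by (auto simp: isometry_mat_def)
  have BB: "(\<Sum>j<N. B $$ (j,a) * B $$ (j,c)) = (if a = c then 1 else 0)" if "a < k" "c < k" for a c
    using arg_cong[OF B(2), of "\<lambda>M. M $$ (a,c)"] B(1) that
    by (simp add: scalar_prod_def lessThan_atLeast0)
  have Bu: "(\<Sum>j<N. B $$ (j,a) * u $ j) = 0" if "a < k" for a
    using arg_cong[OF u(3), of "\<lambda>w. w $ a"] B(1) that u(1)
    by (simp add: scalar_prod_def lessThan_atLeast0)
  have uB: "(\<Sum>j<N. u $ j * B $$ (j,a)) = 0" if "a < k" for a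
    using Bu[OF that] by (simp add: mult.commute)
  have uu: "(\<Sum>j<N. u $ j * u $ j) = 1" using u by (simp add: scalar_prod_def lessThan_atLeast0)
  have "transpose_mat B' * B' = 1\<^sub>m (Suc k)"
  proof (intro eq_matI)
    fix a c assume ac: "a < dim_row (1\<^sub>m (Suc k))" "c < dim_col (1\<^sub>m (Suc k))"
    have "(transpose_mat B' * B') $$ (a,c) = (\<Sum>j<N. B' $$ (j,a) * B' $$ (j,c))"
      using ac by (simp add: B'_def scalar_prod_def lessThan_atLeast0)
    also have "\<dots> = 1\<^sub>m (Suc k) $$ (a,c)"
      using ac BB[of a c] Bu[of a] uB[of c] uu
      by (cases "a < k"; cases "c < k") (simp_all add: B'_def)
    finally show "(transpose_mat B' * B') $$ (a,c) = 1\<^sub>m (Suc k) $$ (a,c)" .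
  qed (auto simp: B'_def)
  then show "isometry_mat N (Suc k) B'" by (simp add: isometry_mat_def B'_def)
  fix v :: "real vec" assume "v \<in> carrier_vec (Suc k)"
  then show "B' *\<^sub>v v = B *\<^sub>v vec k (($) v) + v $ k \<cdot>\<^sub>v u"
    using B u(1) by (intro eq_vecI) (auto simp: B'_def scalar_prod_def)
qed

text \<open>
  An orthonormal system in \<open>W\<close> that cannot be enlarged inside \<open>W\<close> spans \<open>W\<close>: otherwise
  the component of some \<open>w \<in> W\<close> orthogonal to the system, normalised, could be added to it.
\<close>

lemma orthonormal_basis_exists:
  assumes sub: "W \<subseteq> carrier_vec N" and zero: "0\<^sub>v N \<in> W"
    and add: "\<And>v w. v \<in> W \<Longrightarrow> w \<in> W \<Longrightarrow> v + w \<in> W"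
    and smult: "\<And>c v. v \<in> W \<Longrightarrow> c \<cdot>\<^sub>v v \<in> (W :: real vec set)"
  obtains k B where "isometry_mat N k B" "\<And>w. w \<in> W \<Longrightarrow> (B * transpose_mat B) *\<^sub>v w = w"
    "\<And>v. v \<in> carrier_vec k \<Longrightarrow> B *\<^sub>v v \<in> W"
proof -
  define Q where "Q k \<longleftrightarrow> (\<exists>B. isometry_mat N k B \<and> (\<forall>v \<in> carrier_vec k. B *\<^sub>v v \<in> W))" for k
  have "(0\<^sub>m N 0 :: real mat) *\<^sub>v v = 0\<^sub>v N" if "v \<in> carrier_vec 0" for v :: "real vec"
    using that by (intro eq_vecI) (auto simp: scalar_prod_def)
  then have Q0: "Q 0" unfolding Q_def
    by (intro exI[of _ "0\<^sub>m N 0"]) (auto simp: isometry_mat_def zero intro!: eq_matI)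
  \<comment> \<open>Orthonormal systems have at most \<open>N\<close> members, so a maximal one exists.\<close>
  have "\<not> Q (Suc N)" using isometry_le unfolding Q_def by fastforce
  then obtain k where "Q k" "\<not> Q (Suc k)"
    using Q0 by (metis nat_induct)
  then obtain B where iso: "isometry_mat N k B" and BW: "\<forall>v \<in> carrier_vec k. B *\<^sub>v v \<in> W"
    by (auto simp: Q_def)
  have B: "B \<in> carrier_mat N k" "transpose_mat B \<in> carrier_mat k N" "B * transpose_mat B \<in> carrier_mat N N"
    using iso by (auto simp: isometry_mat_def)
  have "(B * transpose_mat B) *\<^sub>v w = w" if w: "w \<in> W" for w
  proof (rule ccontr)
    assume ne: "(B * transpose_mat B) *\<^sub>v w \<noteq> w"
    have wc: "w \<in> carrier_vec N" using w sub by auto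
    define p where "p = (B * transpose_mat B) *\<^sub>v w"
    define u where "u = w + (-1) \<cdot>\<^sub>v p"
    have p: "p = B *\<^sub>v (transpose_mat B *\<^sub>v w)" unfolding p_def using B wc by (simp add: assoc_mult_mat_vec)
    then have pW: "p \<in> W" using BW B wc by auto
    then have pc: "p \<in> carrier_vec N" using sub by auto
    have uW: "u \<in> W" unfolding u_def using w pW add smult by blast
    then have uc: "u \<in> carrier_vec N" using sub by auto
    have u0: "u \<noteq> 0\<^sub>v N"
    proof
      assume "u = 0\<^sub>v N"
      then have "u $ i = 0" if "i < N" for i using that by simp
      then have "p = w" using pc wc by (intro eq_vecI) (auto simp: u_def)
      then show False using ne p_def by simp
    qed
    have "transpose_mat B *\<^sub>v p = transpose_mat B *\<^sub>v w"
      unfolding p_def using isometry_proj(2)[OF iso] B wc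
      by (metis assoc_mult_mat_vec)
    then have Bu: "transpose_mat B *\<^sub>v u = 0\<^sub>v k"
      unfolding u_def using B wc pc
      by (auto simp: mult_add_distrib_mat_vec[OF B(2)] mult_mat_vec[OF B(2)])
    have "u \<bullet> u \<ge> 0" by (auto simp: scalar_prod_def intro: sum_nonneg)
    with scalar_prod_self_eq_0[OF _ uc] u0 have uu: "u \<bullet> u > 0" by (auto simp: order_less_le)
    define u' where "u' = (1 / sqrt (u \<bullet> u)) \<cdot>\<^sub>v u"
    have u': "u' \<in> carrier_vec N" "u' \<in> W" "u' \<bullet> u' = 1" "transpose_mat B *\<^sub>v u' = 0\<^sub>v k"
      using uc uW smult uu Bu by (auto simp: u'_def mult_mat_vec[OF B(2)])
    obtain B' where "isometry_mat N (Suc k) B'"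
      and B': "\<And>v. v \<in> carrier_vec (Suc k) \<Longrightarrow> B' *\<^sub>v v = B *\<^sub>v vec k (($) v) + v $ k \<cdot>\<^sub>v u'"
      using isometry_snoc[OF iso u'(1,3,4)] by blast
    moreover have "B' *\<^sub>v v \<in> W" if "v \<in> carrier_vec (Suc k)" for v
      using that BW u' by (simp add: B' add smult)
    ultimately have "Q (Suc k)" by (auto simp: Q_def)
    with \<open>\<not> Q (Suc k)\<close> show False by simp
  qed
  then show thesis using that iso BW by blast
qed

lemma mat_eq_by_action:
  fixes A B :: "'a :: comm_ring_1 mat"
  assumes "A \<in> carrier_mat n m" "B \<in> carrier_mat n m"
    "\<And>v. v \<in> carrier_vec m \<Longrightarrow> A *\<^sub>v v = B *\<^sub>v v"
  shows "A = B"
proof (rule eq_matI)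
  fix i j assume ij: "i < dim_row B" "j < dim_col B"
  have "(A *\<^sub>v unit_vec m j) $ i = (B *\<^sub>v unit_vec m j) $ i" using assms(3)[of "unit_vec m j"] by simp
  then show "A $$ (i,j) = B $$ (i,j)" using ij assms(1,2) by simp
qed (use assms in auto)

text \<open>
  The columns of \<open>C\<close> form an orthonormal basis of the kernel of the projection \<open>B * B\<^sup>T\<close>, that is, of
  the orthogonal complement of the span of the columns of \<open>B\<close>.
\<close>

lemma isometry_complement:
  assumes iso: "isometry_mat N k B"
  obtains k' C where "isometry_mat N k' C" "B * transpose_mat B + C * transpose_mat C = 1\<^sub>m N" "k + k' = N"
proof -
  define P where "P = B * transpose_mat B"
  have B: "B \<in> carrier_mat N k" "transpose_mat B \<in> carrier_mat k N" and P: "P \<in> carrier_mat N N"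
    using iso by (auto simp: isometry_mat_def P_def)
  have symP: "transpose_mat P = P" using B by (simp add: P_def transpose_mult[OF B(1,2)])
  have idem: "P * P = P"
    using isometry_proj(1)[OF iso] P unfolding P_def[symmetric] by (metis P_def B assoc_mult_mat)
  define W where "W = {v \<in> carrier_vec N. P *\<^sub>v v = 0\<^sub>v N}"
  obtain k' C where isoC: "isometry_mat N k' C"
    and CW: "\<And>w. w \<in> W \<Longrightarrow> (C * transpose_mat C) *\<^sub>v w = w"
    and WC: "\<And>v. v \<in> carrier_vec k' \<Longrightarrow> C *\<^sub>v v \<in> W"
  proof (rule orthonormal_basis_exists[of W N])
    show "c \<cdot>\<^sub>v v \<in> W" if "v \<in> W" for c v
      using that P by (auto simp: W_def mult_mat_vec[OF P])
  qed (use P in \<open>auto simp: W_def mult_add_distrib_mat_vec[OF P]\<close>)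
  define R where "R = C * transpose_mat C"
  have C: "C \<in> carrier_mat N k'" "transpose_mat C \<in> carrier_mat k' N" and R: "R \<in> carrier_mat N N"
    using isoC by (auto simp: isometry_mat_def R_def)
  have symR: "transpose_mat R = R" using C by (simp add: R_def transpose_mult[OF C(1,2)])
  have PC: "P * C = 0\<^sub>m N k'"
    by (rule mat_eq_by_action[of _ N k'])
       (use P C WC in \<open>auto simp: W_def assoc_mult_mat_vec[OF P C(1)] intro!: eq_vecI\<close>)
  have "P * R = 0\<^sub>m N N" unfolding R_def
    using PC C by (simp flip: assoc_mult_mat[OF P C])
  then have RP: "R * P = 0\<^sub>m N N"
    using transpose_mult[OF P R] symR symP by simp
  have sum: "P + R = 1\<^sub>m N"
  proof (rule mat_eq_by_action[of _ N N])
    fix v :: "real vec" assume v: "v \<in> carrier_vec N"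
    have Pv: "P *\<^sub>v v \<in> carrier_vec N" using P v by auto
    have "P *\<^sub>v (v - P *\<^sub>v v) = 0\<^sub>v N"
      using v Pv idem by (simp add: mult_minus_distrib_mat_vec[OF P] flip: assoc_mult_mat_vec[OF P P])
    then have "R *\<^sub>v (v - P *\<^sub>v v) = v - P *\<^sub>v v"
      unfolding R_def by (intro CW) (use v Pv in \<open>auto simp: W_def\<close>)
    moreover have "R *\<^sub>v (P *\<^sub>v v) = 0\<^sub>v N"
      using RP v by (subst assoc_mult_mat_vec[OF R P v, symmetric]) (auto intro!: eq_vecI)
    ultimately have Rv: "R *\<^sub>v v = v - P *\<^sub>v v"
      using mult_minus_distrib_mat_vec[OF R v Pv] R v by auto
    have "(P + R) *\<^sub>v v = P *\<^sub>v v + (v - P *\<^sub>v v)"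
      by (simp only: add_mult_distrib_mat_vec[OF P R v] Rv)
    also have "\<dots> = v" using v P by (intro eq_vecI) auto
    finally show "(P + R) *\<^sub>v v = 1\<^sub>m N *\<^sub>v v" using v by simp
  qed (use P R in auto)
  have "real k + real k' = (\<Sum>j<N. P $$ (j,j)) + (\<Sum>j<N. R $$ (j,j))"
    using isometry_trace[OF iso] isometry_trace[OF isoC] by (simp add: P_def R_def)
  also have "\<dots> = (\<Sum>j<N. (P + R) $$ (j,j))" using P R by (simp add: sum.distrib)
  also have "\<dots> = real N" unfolding sum by simp
  finally have "k + k' = N" by linarith
  then show thesis using that[OF isoC] sum by (simp add: P_def R_def)
qed

section \<open>Decomposition of orthogonal representations\<close>

lemma real_subspace_iff:
  "VectorSpace.subspace class_ring W (module_vec TYPE(real) d) \<longleftrightarrow>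
     W \<subseteq> carrier_vec d \<and> 0\<^sub>v d \<in> W \<and> (\<forall>v\<in>W. \<forall>w\<in>W. v + w \<in> W) \<and> (\<forall>c. \<forall>v\<in>W. c \<cdot>\<^sub>v v \<in> W)"
  unfolding VectorSpace.subspace_def submodule_def
  using vec_vs vec_module by (auto simp: module_vec_simps)

text \<open>
  Invertibility of \<open>\<sigma> g\<close> is implied by orthogonality, and \<open>\<sigma> 1 = 1\<close> then follows from multiplicativity,
  so this is a homomorphism into the orthogonal group.
\<close>

definition orthogonal_rep :: "('g, 'b) monoid_scheme \<Rightarrow> nat \<Rightarrow> ('g \<Rightarrow> real mat) \<Rightarrow> bool" where
  "orthogonal_rep G N \<sigma> \<longleftrightarrow>
     (\<forall>g \<in> carrier G. \<sigma> g \<in> carrier_mat N N \<and> transpose_mat (\<sigma> g) * \<sigma> g = 1\<^sub>m N) \<and>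
     (\<forall>g \<in> carrier G. \<forall>g' \<in> carrier G. \<sigma> (g \<otimes>\<^bsub>G\<^esub> g') = \<sigma> g * \<sigma> g')"

lemma GL_real_carrier:
  "A \<in> carrier (GL_real n) \<longleftrightarrow>
     A \<in> carrier_mat n n \<and> (\<exists>B \<in> carrier_mat n n. B * A = 1\<^sub>m n \<and> A * B = 1\<^sub>m n)"
  by (auto simp: GL_real_def units_of_def Units_def ring_mat_simps)

lemma orthogonal_mat_right:
  fixes A :: "real mat"
  assumes "A \<in> carrier_mat N N" "transpose_mat A * A = 1\<^sub>m N" shows "A * transpose_mat A = 1\<^sub>m N"
  using mat_mult_left_right_inverse[of "transpose_mat A" N A] assms by auto

lemma real_rep_mult:
  assumes "real_rep G n \<phi>" "g \<in> carrier G" "g' \<in> carrier G"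
  shows "\<phi> (g \<otimes>\<^bsub>G\<^esub> g') = \<phi> g * \<phi> g'"
  using assms by (auto simp: hom_def GL_real_def units_of_def ring_mat_simps)

lemma real_rep_carrier:
  assumes "real_rep G n \<phi>" "g \<in> carrier G" shows "\<phi> g \<in> carrier_mat n n"
  using assms by (auto simp: hom_def GL_real_carrier)

lemma orthogonal_rep_real_rep:
  assumes "orthogonal_rep G N \<sigma>" shows "real_rep G N \<sigma>"
proof -
  have "\<sigma> g \<in> carrier (GL_real N)" if "g \<in> carrier G" for g
    using assms that orthogonal_mat_right[of "\<sigma> g" N] unfolding GL_real_carrier orthogonal_rep_def
    by (intro conjI bexI[of _ "transpose_mat (\<sigma> g)"]) auto
  then show ?thesis using assms
    by (auto simp: hom_def orthogonal_rep_def GL_real_def units_of_def ring_mat_simps)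
qed

lemma orthogonal_rep_inv:
  assumes G: "group G" and \<sigma>: "orthogonal_rep G N \<sigma>" and g: "g \<in> carrier G"
  shows "\<sigma> (inv\<^bsub>G\<^esub> g) = transpose_mat (\<sigma> g)"
proof -
  interpret group G by fact
  have c: "\<sigma> x \<in> carrier_mat N N" "transpose_mat (\<sigma> x) * \<sigma> x = 1\<^sub>m N" if "x \<in> carrier G" for x
    using \<sigma> that by (auto simp: orthogonal_rep_def)
  have m: "\<sigma> (x \<otimes>\<^bsub>G\<^esub> y) = \<sigma> x * \<sigma> y" if "x \<in> carrier G" "y \<in> carrier G" for x y
    using \<sigma> that by (auto simp: orthogonal_rep_def)
  have t: "transpose_mat (\<sigma> x) \<in> carrier_mat N N" if "x \<in> carrier G" for x using c that by simp
  have "\<sigma> \<one>\<^bsub>G\<^esub> = transpose_mat (\<sigma> \<one>\<^bsub>G\<^esub>) * (\<sigma> \<one>\<^bsub>G\<^esub> * \<sigma> \<one>\<^bsub>G\<^esub>)"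
    using c[OF one_closed] t[OF one_closed] by (simp flip: assoc_mult_mat[OF t c(1) c(1)])
  also have "\<sigma> \<one>\<^bsub>G\<^esub> * \<sigma> \<one>\<^bsub>G\<^esub> = \<sigma> \<one>\<^bsub>G\<^esub>" by (simp flip: m)
  finally have one: "\<sigma> \<one>\<^bsub>G\<^esub> = 1\<^sub>m N" using c by simp
  have "\<sigma> (inv\<^bsub>G\<^esub> g) = \<sigma> (inv\<^bsub>G\<^esub> g) * (\<sigma> g * transpose_mat (\<sigma> g))"
    using c(1)[of "inv\<^bsub>G\<^esub> g"] g orthogonal_mat_right[OF c[OF g]] by simp
  also have "\<dots> = (\<sigma> (inv\<^bsub>G\<^esub> g) * \<sigma> g) * transpose_mat (\<sigma> g)"
    using assoc_mult_mat[OF c(1) c(1) t, of "inv\<^bsub>G\<^esub> g" g g] g by simp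
  also have "\<sigma> (inv\<^bsub>G\<^esub> g) * \<sigma> g = 1\<^sub>m N" using g one by (simp flip: m)
  finally show ?thesis using t[OF g] by simp
qed

text \<open>
  The hypothesis says that the range of the orthogonal projection \<open>P\<close> is invariant. Since
  \<open>\<sigma> g\<close> is the transpose of \<open>\<sigma> (g\<inverse>)\<close>, transposing the hypothesis for \<open>g\<inverse>\<close> shows that the kernel of
  \<open>P\<close> is invariant too, and the two facts together say that \<open>P\<close> commutes with the action.
\<close>

lemma invariant_projection_commutes:
  assumes G: "group G" and \<sigma>: "orthogonal_rep G N \<sigma>" and g: "g \<in> carrier G"
    and P: "P \<in> carrier_mat N N" and sym: "transpose_mat P = P"
    and inv: "\<And>g. g \<in> carrier G \<Longrightarrow> P * (\<sigma> g * P) = \<sigma> g * P"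
  shows "P * \<sigma> g = \<sigma> g * P"
proof -
  interpret group G by fact
  have c: "\<sigma> x \<in> carrier_mat N N" if "x \<in> carrier G" for x
    using \<sigma> that by (auto simp: orthogonal_rep_def)
  let ?i = "inv\<^bsub>G\<^esub> g"
  have i: "?i \<in> carrier G" using g by simp
  have st: "transpose_mat (\<sigma> ?i) = \<sigma> g" using orthogonal_rep_inv[OF G \<sigma> i] g by simp
  have "transpose_mat (P * (\<sigma> ?i * P)) = transpose_mat (\<sigma> ?i * P)" using inv[OF i] by simp
  then have "(P * \<sigma> g) * P = P * \<sigma> g"
    using P c[OF i] transpose_mult[OF P, of "\<sigma> ?i * P" N] transpose_mult[OF c[OF i] P]
    by (simp add: st sym)
  then show ?thesis using inv[OF g] assoc_mult_mat[OF P c[OF g] P] by simp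
qed

text \<open>
  The restriction of \<open>\<sigma>\<close> to the invariant subspace spanned by the columns of \<open>B\<close>, in the coordinates given by
  these columns, is again orthogonal, and \<open>B\<^sup>T\<close> intertwines \<open>\<sigma>\<close> with it.
\<close>

lemma orthogonal_rep_compress:
  assumes \<sigma>: "orthogonal_rep G N \<sigma>" and iso: "isometry_mat N k B"
    and comm: "\<And>g. g \<in> carrier G \<Longrightarrow> (B * transpose_mat B) * \<sigma> g = \<sigma> g * (B * transpose_mat B)"
  shows "orthogonal_rep G k (\<lambda>g. transpose_mat B * \<sigma> g * B)"
    and "\<And>g. g \<in> carrier G \<Longrightarrow> transpose_mat B * \<sigma> g = (transpose_mat B * \<sigma> g * B) * transpose_mat B"
proof -
  let ?P = "B * transpose_mat B"
  have B: "B \<in> carrier_mat N k" "transpose_mat B \<in> carrier_mat k N" "transpose_mat B * B = 1\<^sub>m k"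
    and P: "?P \<in> carrier_mat N N" using iso by (auto simp: isometry_mat_def)
  have c: "\<sigma> x \<in> carrier_mat N N" "transpose_mat (\<sigma> x) \<in> carrier_mat N N"
      "transpose_mat (\<sigma> x) * \<sigma> x = 1\<^sub>m N" if "x \<in> carrier G" for x
    using \<sigma> that by (auto simp: orthogonal_rep_def)
  show int: "transpose_mat B * \<sigma> g = (transpose_mat B * \<sigma> g * B) * transpose_mat B"
    if g: "g \<in> carrier G" for g
  proof -
    have "transpose_mat B * \<sigma> g = (transpose_mat B * ?P) * \<sigma> g"
      using isometry_proj(2)[OF iso] by simp
    also have "\<dots> = transpose_mat B * (?P * \<sigma> g)" by (rule assoc_mult_mat[OF B(2) P c(1)[OF g]])
    also have "\<dots> = transpose_mat B * (\<sigma> g * ?P)" by (simp add: comm[OF g])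
    also have "\<dots> = (transpose_mat B * \<sigma> g) * ?P" using assoc_mult_mat[OF B(2) c(1)[OF g] P] by simp
    also have "\<dots> = (transpose_mat B * \<sigma> g * B) * transpose_mat B"
      using B c(1)[OF g] by (intro assoc_mult_mat[symmetric, of _ k N _ k _ N]) auto
    finally show ?thesis .
  qed
  have mult: "(transpose_mat B * \<sigma> g * B) * (transpose_mat B * \<tau> * B) = transpose_mat B * (\<sigma> g * \<tau>) * B"
    if g: "g \<in> carrier G" and \<tau>: "\<tau> \<in> carrier_mat N N" for g \<tau>
  proof -
    let ?S = "transpose_mat B * \<sigma> g * B"
    have S: "?S \<in> carrier_mat k k" using B c(1)[OF g] by auto
    have T: "transpose_mat B * \<tau> \<in> carrier_mat k N" using B \<tau> by auto
    have "?S * (transpose_mat B * \<tau> * B) = ?S * (transpose_mat B * \<tau>) * B"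
      using assoc_mult_mat[OF S T B(1)] by simp
    also have "?S * (transpose_mat B * \<tau>) = ?S * transpose_mat B * \<tau>"
      using assoc_mult_mat[OF S B(2) \<tau>] by simp
    also have "?S * transpose_mat B * \<tau> = transpose_mat B * (\<sigma> g * \<tau>)"
      by (simp only: int[OF g, symmetric] assoc_mult_mat[OF B(2) c(1)[OF g] \<tau>])
    finally show ?thesis .
  qed
  have tr: "transpose_mat (transpose_mat B * \<sigma> g * B) = transpose_mat B * transpose_mat (\<sigma> g) * B"
    if g: "g \<in> carrier G" for g
    using B c[OF g] transpose_mult[of "transpose_mat B * \<sigma> g" k N B k]
      transpose_mult[OF B(2) c(1)[OF g]] assoc_mult_mat[OF B(2) c(2)[OF g] B(1)]
    by auto
  show "orthogonal_rep G k (\<lambda>g. transpose_mat B * \<sigma> g * B)"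
    unfolding orthogonal_rep_def
  proof (intro conjI ballI)
    fix g assume g: "g \<in> carrier G"
    show "transpose_mat B * \<sigma> g * B \<in> carrier_mat k k" using B c(1)[OF g] by auto
    let ?t = "transpose_mat (\<sigma> g)"
    let ?S = "transpose_mat B * ?t * B"
    let ?U = "transpose_mat B * \<sigma> g"
    have U: "?U \<in> carrier_mat k N" "transpose_mat B * ?t \<in> carrier_mat k N" using B c[OF g] by auto
    have "?S * (?U * B) = transpose_mat B * ?t * (B * (?U * B))"
      using U B by (intro assoc_mult_mat[of _ k N _ k _ k]) auto
    also have "B * (?U * B) = ?P * (\<sigma> g * B)"
      using B c(1)[OF g] by (simp add: assoc_mult_mat[of _ N k _ N _ k] assoc_mult_mat[of _ k N _ N _ k])
    also have "\<dots> = \<sigma> g * (?P * B)"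
      by (simp only: assoc_mult_mat[OF P c(1)[OF g] B(1), symmetric] comm[OF g]
          assoc_mult_mat[OF c(1)[OF g] P B(1)])
    also have "?P * B = B" by (rule isometry_proj(1)[OF iso])
    also have "transpose_mat B * ?t * (\<sigma> g * B) = transpose_mat B * (?t * (\<sigma> g * B))"
      using B c[OF g] by (intro assoc_mult_mat[of _ k N _ N _ k]) auto
    also have "?t * (\<sigma> g * B) = B"
      using c[OF g] B assoc_mult_mat[OF c(2)[OF g] c(1)[OF g] B(1)] by simp
    also have "transpose_mat B * B = 1\<^sub>m k" by (rule B(3))
    finally show "transpose_mat (?U * B) * (?U * B) = 1\<^sub>m k" using tr[OF g] by simp
  next
    fix g g' assume "g \<in> carrier G" "g' \<in> carrier G"
    then show "transpose_mat B * \<sigma> (g \<otimes>\<^bsub>G\<^esub> g') * B =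
        (transpose_mat B * \<sigma> g * B) * (transpose_mat B * \<sigma> g' * B)"
      using mult c(1) \<sigma> by (simp add: orthogonal_rep_def)
  qed
qed

text \<open>
  This is the part of Schur's lemma that holds for every real irreducible representation, also when
  its commutant is larger than the real numbers. The matrix \<open>T\<^sup>T * T\<close> commutes with \<open>\<sigma>\<close> because
  both representations are orthogonal, and being symmetric it has a real eigenvector. The
  eigenspace is a nonzero invariant subspace, hence everything. Thus \<open>T / sqrt c\<close> is an
  orthogonal equivalence of \<open>\<sigma>\<close> and \<open>\<tau>\<close>.
\<close>

lemma orthogonal_intertwiner_scalar:
  assumes \<sigma>: "orthogonal_rep G N \<sigma>" and irr: "irreducible_rep G N \<sigma>"
    and \<tau>: "orthogonal_rep G N \<tau>" and T: "T \<in> carrier (GL_real N)"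
    and int: "\<And>g. g \<in> carrier G \<Longrightarrow> T * \<sigma> g = \<tau> g * T"
  obtains c where "c > 0" "transpose_mat T * T = c \<cdot>\<^sub>m 1\<^sub>m N"
proof -
  obtain T' where Tc: "T \<in> carrier_mat N N" and T': "T' \<in> carrier_mat N N" "T' * T = 1\<^sub>m N"
    using T by (auto simp: GL_real_carrier)
  define A where "A = transpose_mat T * T"
  have Tt: "transpose_mat T \<in> carrier_mat N N" and A: "A \<in> carrier_mat N N"
    using Tc by (auto simp: A_def)
  have symA: "transpose_mat A = A" using Tc by (simp add: A_def transpose_mult[OF Tt Tc])
  have N: "N > 0" using irr by (simp add: irreducible_rep_def)
  have s: "\<sigma> g \<in> carrier_mat N N" "transpose_mat (\<sigma> g) \<in> carrier_mat N N"
      "\<sigma> g * transpose_mat (\<sigma> g) = 1\<^sub>m N"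
    and t: "\<tau> g \<in> carrier_mat N N" "transpose_mat (\<tau> g) \<in> carrier_mat N N"
      "transpose_mat (\<tau> g) * \<tau> g = 1\<^sub>m N" if "g \<in> carrier G" for g
    using \<sigma> \<tau> that orthogonal_mat_right by (auto simp: orthogonal_rep_def)
  have comm: "A * \<sigma> g = \<sigma> g * A" if g: "g \<in> carrier G" for g
  proof -
    note a = assoc_mult_mat[of _ N N _ N _ N]
    have Ts: "T * \<sigma> g \<in> carrier_mat N N" and As: "A * \<sigma> g \<in> carrier_mat N N"
      and tT: "\<tau> g * T \<in> carrier_mat N N"
      using s[OF g] t[OF g] Tc A by auto
    have "transpose_mat (\<sigma> g) * (A * \<sigma> g) = transpose_mat (\<sigma> g) * (transpose_mat T * (T * \<sigma> g))"
      unfolding A_def by (simp only: a[OF Tt Tc s(1)[OF g]])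
    also have "\<dots> = transpose_mat (T * \<sigma> g) * (T * \<sigma> g)"
      by (simp only: transpose_mult[OF Tc s(1)[OF g]] a[OF s(2)[OF g] Tt Ts])
    also have "\<dots> = transpose_mat (\<tau> g * T) * (\<tau> g * T)" by (simp only: int[OF g])
    also have "\<dots> = transpose_mat T * ((transpose_mat (\<tau> g) * \<tau> g) * T)"
      by (simp only: transpose_mult[OF t(1)[OF g] Tc] a[OF Tt t(2)[OF g] tT]
          a[OF t(2)[OF g] t(1)[OF g] Tc])
    also have "\<dots> = A" using t(3)[OF g] Tc by (simp add: A_def)
    finally have "\<sigma> g * (transpose_mat (\<sigma> g) * (A * \<sigma> g)) = \<sigma> g * A" by simp
    moreover have "\<sigma> g * (transpose_mat (\<sigma> g) * (A * \<sigma> g)) = A * \<sigma> g"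
      using As by (simp add: a[OF s(1)[OF g] s(2)[OF g] As, symmetric] s(3)[OF g] left_mult_one_mat[OF As])
    ultimately show ?thesis by simp
  qed
  obtain c v where v: "v \<in> carrier_vec N" "v \<noteq> 0\<^sub>v N" "A *\<^sub>v v = c \<cdot>\<^sub>v v"
    using symmetric_mat_eigenvector[OF A symA N] by blast
  define W where "W = {w \<in> carrier_vec N. A *\<^sub>v w = c \<cdot>\<^sub>v w}"
  have "VectorSpace.subspace class_ring W (module_vec TYPE(real) N)"
    unfolding real_subspace_iff
  proof (intro conjI ballI allI)
    show "0\<^sub>v N \<in> W" using A by (auto simp: W_def intro!: eq_vecI)
    show "v + w \<in> W" if "v \<in> W" "w \<in> W" for v w
      using that by (auto simp: W_def mult_add_distrib_mat_vec[OF A] smult_add_distrib_vec[of _ N])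
    show "a \<cdot>\<^sub>v w \<in> W" if "w \<in> W" for a w
      using that by (auto simp: W_def mult_mat_vec[OF A] smult_smult_assoc mult.commute)
  qed (auto simp: W_def)
  moreover have "\<sigma> g *\<^sub>v w \<in> W" if g: "g \<in> carrier G" and w: "w \<in> W" for g w
  proof -
    have w': "w \<in> carrier_vec N" "A *\<^sub>v w = c \<cdot>\<^sub>v w" using w by (auto simp: W_def)
    have "A *\<^sub>v (\<sigma> g *\<^sub>v w) = \<sigma> g *\<^sub>v (A *\<^sub>v w)"
      by (simp only: assoc_mult_mat_vec[OF A s(1)[OF g] w'(1), symmetric] comm[OF g]
          assoc_mult_mat_vec[OF s(1)[OF g] A w'(1)])
    then show ?thesis using w' s(1)[OF g] by (auto simp: W_def mult_mat_vec[OF s(1)[OF g]])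
  qed
  moreover have "v \<in> W" using v by (simp add: W_def)
  ultimately have "W = carrier_vec N" using irr v(2) by (auto simp: irreducible_rep_def)
  then have "A *\<^sub>v w = c \<cdot>\<^sub>v w" if "w \<in> carrier_vec N" for w using that by (auto simp: W_def)
  then have Ac: "A = c \<cdot>\<^sub>m 1\<^sub>m N"
    using A by (intro mat_eq_by_action[of _ N N]) auto
  have Tv: "T *\<^sub>v v \<in> carrier_vec N" using Tc v by auto
  have "T *\<^sub>v v \<noteq> 0\<^sub>v N"
  proof
    assume 0: "T *\<^sub>v v = 0\<^sub>v N"
    have "v = T' *\<^sub>v (T *\<^sub>v v)" using T' v assoc_mult_mat_vec[OF T'(1) Tc v(1)] by simp
    also have "\<dots> = 0\<^sub>v N" unfolding 0 using T' by (auto intro!: eq_vecI)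
    finally show False using v(2) by simp
  qed
  moreover have nonneg: "w \<bullet> w \<ge> 0" for w :: "real vec"
    by (auto simp: scalar_prod_def intro: sum_nonneg)
  ultimately have "(T *\<^sub>v v) \<bullet> (T *\<^sub>v v) > 0" using scalar_prod_self_eq_0[OF _ Tv] by (auto simp: order_less_le)
  also have "(T *\<^sub>v v) \<bullet> (T *\<^sub>v v) = v \<bullet> (A *\<^sub>v v)"
    unfolding A_def using transpose_vec_mult_scalar[OF Tc v(1) Tv] assoc_mult_mat_vec[OF Tt Tc v(1)]
      comm_scalar_prod[OF v(1), of "transpose_mat T *\<^sub>v (T *\<^sub>v v)"] Tt Tv by simp
  also have "\<dots> = c * (v \<bullet> v)" using v by simp
  finally have "c > 0" using nonneg[of v] by (simp add: zero_less_mult_iff)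
  then show thesis using that Ac by (simp add: A_def)
qed

lemma sum_list_weighted_swap:
  fixes w :: "_ \<Rightarrow> _ \<Rightarrow> 'a :: comm_semiring_1"
  shows "(\<Sum>x\<leftarrow>xs. \<Sum>p\<in>A. \<Sum>q\<in>B. w p q * F x p q) = (\<Sum>p\<in>A. \<Sum>q\<in>B. w p q * (\<Sum>x\<leftarrow>xs. F x p q))"
  by (induction xs) (auto simp: sum.distrib distrib_left)

text \<open>
  A finite family of intertwiners \<open>T\<close> from \<open>\<sigma>\<close> to the representations \<open>\<rho> i\<close> with
  \<open>\<Sum> T\<^sup>T * T = 1\<close>, so that \<open>|v|\<^sup>2 = \<Sum> |T v|\<^sup>2\<close>. For irreducible \<open>\<rho> i\<close> this plays the role of an orthogonal
  decomposition of \<open>\<sigma>\<close> into irreducibles, without naming the summands as subspaces.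
  The identity is stated entry by entry
  because matrices of unspecified dimension have no common zero, so that a list of them cannot be summed.
\<close>

definition parseval_frame ::
  "('g, 'b) monoid_scheme \<Rightarrow> nat \<Rightarrow> (nat \<Rightarrow> nat) \<Rightarrow> (nat \<Rightarrow> 'g \<Rightarrow> real mat) \<Rightarrow>
     nat \<Rightarrow> ('g \<Rightarrow> real mat) \<Rightarrow> (nat \<times> real mat) list \<Rightarrow> bool" where
  "parseval_frame G h d \<rho> N \<sigma> ts \<longleftrightarrow>
     (\<forall>(i,T)\<in>set ts. i < h \<and> T \<in> carrier_mat (d i) N \<and> (\<forall>g\<in>carrier G. T * \<sigma> g = \<rho> i g * T)) \<and>
     (\<forall>a<N. \<forall>c<N. (\<Sum>(i,T)\<leftarrow>ts. (transpose_mat T * T) $$ (a,c)) = (1\<^sub>m N :: real mat) $$ (a,c))"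

text \<open>
  The intertwiners of the restriction to the span of the columns of \<open>B\<close> are composed with \<open>B\<^sup>T\<close>, and
  \<open>\<Sum> (T * B\<^sup>T)\<^sup>T * (T * B\<^sup>T) = B * (\<Sum> T\<^sup>T * T) * B\<^sup>T = B * B\<^sup>T\<close>.
\<close>

lemma parseval_frame_pullback:
  assumes fr: "parseval_frame G h d \<rho> k (\<lambda>g. transpose_mat B * \<sigma> g * B) ts"
    and d: "\<And>i g. i < h \<Longrightarrow> g \<in> carrier G \<Longrightarrow> \<rho> i g \<in> carrier_mat (d i) (d i)"
    and \<sigma>: "\<And>g. g \<in> carrier G \<Longrightarrow> \<sigma> g \<in> carrier_mat N N"
    and B: "B \<in> carrier_mat N k"
    and int: "\<And>g. g \<in> carrier G \<Longrightarrow> transpose_mat B * \<sigma> g = (transpose_mat B * \<sigma> g * B) * transpose_mat B"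
  defines "us \<equiv> map (\<lambda>(i,T). (i, T * transpose_mat B)) ts"
  shows "\<forall>(i,T)\<in>set us. i < h \<and> T \<in> carrier_mat (d i) N \<and> (\<forall>g\<in>carrier G. T * \<sigma> g = \<rho> i g * T)"
    and "\<And>a c. a < N \<Longrightarrow> c < N \<Longrightarrow>
      (\<Sum>(i,T)\<leftarrow>us. (transpose_mat T * T) $$ (a,c)) = (B * transpose_mat B) $$ (a,c)"
proof -
  have Bt: "transpose_mat B \<in> carrier_mat k N" using B by simp
  have ts: "i < h" "T \<in> carrier_mat (d i) k"
     "\<And>g. g\<in>carrier G \<Longrightarrow> T * (transpose_mat B * \<sigma> g * B) = \<rho> i g * T" if "(i,T) \<in> set ts" for i T
    using fr that unfolding parseval_frame_def by fast+
  have us: "T * transpose_mat B * \<sigma> g = \<rho> i g * (T * transpose_mat B)"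
    if iT: "(i,T) \<in> set ts" and g: "g \<in> carrier G" for i T g
  proof -
    have S: "transpose_mat B * \<sigma> g * B \<in> carrier_mat k k" using \<sigma>[OF g] B by auto
    have "T * transpose_mat B * \<sigma> g = T * (transpose_mat B * \<sigma> g)"
      by (rule assoc_mult_mat[OF ts(2)[OF iT] Bt \<sigma>[OF g]])
    also have "\<dots> = T * ((transpose_mat B * \<sigma> g * B) * transpose_mat B)" by (subst int[OF g]) (rule refl)
    also have "\<dots> = T * (transpose_mat B * \<sigma> g * B) * transpose_mat B"
      by (rule assoc_mult_mat[OF ts(2)[OF iT] S Bt, symmetric])
    also have "\<dots> = \<rho> i g * (T * transpose_mat B)"
      by (simp only: ts(3)[OF iT g] assoc_mult_mat[OF d[OF ts(1)[OF iT] g] ts(2)[OF iT] Bt])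
    finally show ?thesis .
  qed
  show "\<forall>(i,T)\<in>set us. i < h \<and> T \<in> carrier_mat (d i) N \<and> (\<forall>g\<in>carrier G. T * \<sigma> g = \<rho> i g * T)"
    unfolding us_def using us ts(1) mult_carrier_mat[OF ts(2) Bt] by auto
  fix a c assume ac: "a < N" "c < N"
  have entry: "(transpose_mat (T * transpose_mat B) * (T * transpose_mat B)) $$ (a,c)
      = (\<Sum>p<k. \<Sum>q<k. (B $$ (a,p) * B $$ (c,q)) * (transpose_mat T * T) $$ (p,q))"
    if "(i,T) \<in> set ts" for i T
  proof -
    have T: "T \<in> carrier_mat (d i) k" "transpose_mat T \<in> carrier_mat k (d i)" using ts(2)[OF that] by auto
    define M where "M = transpose_mat T * T"
    have M: "M \<in> carrier_mat k k" using T by (auto simp: M_def)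
    have "transpose_mat (T * transpose_mat B) * (T * transpose_mat B) = B * (M * transpose_mat B)"
      using assoc_mult_mat[OF B T(2) mult_carrier_mat[OF T(1) Bt]] assoc_mult_mat[OF T(2,1) Bt]
      by (simp add: M_def transpose_mult[OF T(1) Bt])
    also have "\<dots> $$ (a,c) = (\<Sum>p<k. \<Sum>q<k. (B $$ (a,p) * B $$ (c,q)) * M $$ (p,q))"
      using ac B M by (simp add: scalar_prod_def lessThan_atLeast0 sum_distrib_left mult_ac)
    finally show ?thesis by (simp add: M_def)
  qed
  have "(\<Sum>(i,T)\<leftarrow>us. (transpose_mat T * T) $$ (a,c))
      = (\<Sum>(i,T)\<leftarrow>ts. \<Sum>p<k. \<Sum>q<k. (B $$ (a,p) * B $$ (c,q)) * (transpose_mat T * T) $$ (p,q))"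
    unfolding us_def by (auto simp: entry o_def intro!: arg_cong[of _ _ sum_list])
  also have "\<dots> = (\<Sum>p<k. \<Sum>q<k. (B $$ (a,p) * B $$ (c,q)) * (\<Sum>(i,T)\<leftarrow>ts. (transpose_mat T * T) $$ (p,q)))"
    unfolding case_prod_beta by (rule sum_list_weighted_swap)
  also have "\<dots> = (\<Sum>p<k. \<Sum>q<k. (B $$ (a,p) * B $$ (c,q)) * (if p = q then 1 else 0))"
    using fr by (intro sum.cong refl) (auto simp: parseval_frame_def)
  also have "\<dots> = (B * transpose_mat B) $$ (a,c)"
    using ac B by (simp add: scalar_prod_def lessThan_atLeast0 if_distrib cong: if_cong)
  finally show "(\<Sum>(i,T)\<leftarrow>us. (transpose_mat T * T) $$ (a,c)) = (B * transpose_mat B) $$ (a,c)" .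
qed

lemma orthogonal_irreps_rep:
  assumes "orthogonal_irreps G h d \<rho>" "i < h" shows "orthogonal_rep G (d i) (\<rho> i)"
  using assms real_rep_carrier real_rep_mult
  by (fastforce simp: orthogonal_irreps_def irreducible_rep_def orthogonal_rep_def)

text \<open>
  Induction on the dimension. An irreducible \<open>\<sigma>\<close> is equivalent to some \<open>\<rho> i\<close>, and the equivalence can be
  rescaled to an isometry. Otherwise an invariant subspace and its orthogonal complement carry
  smaller representations, and their families, pulled back, sum to \<open>P + (1 - P) = 1\<close>.
\<close>

lemma parseval_frame_exists:
  assumes G: "group G" and irr: "orthogonal_irreps G h d \<rho>" and "orthogonal_rep G N \<sigma>"
  shows "\<exists>ts. parseval_frame G h d \<rho> N \<sigma> ts"
  using assms(3)
proof (induction N arbitrary: \<sigma> rule: less_induct)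
  case (less N)
  note \<sigma> = less.prems
  have s: "\<sigma> g \<in> carrier_mat N N" if "g \<in> carrier G" for g
    using \<sigma> that by (auto simp: orthogonal_rep_def)
  have rc: "\<rho> i g \<in> carrier_mat (d i) (d i)" if "i < h" "g \<in> carrier G" for i g
    using orthogonal_irreps_rep[OF irr that(1)] that(2) by (auto simp: orthogonal_rep_def)
  consider "N = 0" | "irreducible_rep G N \<sigma>" | "N > 0" "\<not> irreducible_rep G N \<sigma>" by blast
  then show ?case
  proof cases
    case 1
    then show ?thesis by (intro exI[of _ "[]"]) (auto simp: parseval_frame_def)
  next
    case 2
    then obtain i where i: "i < h" "equivalent_reps G N \<sigma> (d i) (\<rho> i)"
      using irr unfolding orthogonal_irreps_def by blast
    then obtain T where N: "d i = N" and T: "T \<in> carrier (GL_real N)"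
      and int: "\<And>g. g \<in> carrier G \<Longrightarrow> T * \<sigma> g = \<rho> i g * T"
      by (auto simp: equivalent_reps_def)
    obtain c where c: "c > 0" "transpose_mat T * T = c \<cdot>\<^sub>m 1\<^sub>m N"
      using orthogonal_intertwiner_scalar[OF \<sigma> 2 _ T int] orthogonal_irreps_rep[OF irr i(1)] N by metis
    have Tc: "T \<in> carrier_mat N N" using T by (simp add: GL_real_carrier)
    define S where "S = (1 / sqrt c) \<cdot>\<^sub>m T"
    have S: "S \<in> carrier_mat N N" using Tc by (simp add: S_def)
    have "S * \<sigma> g = \<rho> i g * S" if g: "g \<in> carrier G" for g
      using int[OF g] mult_smult_assoc_mat[OF Tc s[OF g]] mult_smult_distrib[OF rc[OF i(1) g, unfolded N] Tc]
      by (simp add: S_def)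
    moreover have "(transpose_mat S * S) $$ (a,b) = 1\<^sub>m N $$ (a,b)" if ab: "a < N" "b < N" for a b
    proof -
      have "transpose_mat S * S = (1 / sqrt c * (1 / sqrt c)) \<cdot>\<^sub>m (transpose_mat T * T)"
        using Tc by (intro eq_matI) (auto simp: S_def scalar_prod_def sum_distrib_left sum_divide_distrib)
      also have "\<dots> = 1\<^sub>m N" unfolding c(2) using c(1) by (intro eq_matI) auto
      finally show ?thesis by simp
    qed
    ultimately show ?thesis using i(1) S N by (intro exI[of _ "[(i,S)]"]) (auto simp: parseval_frame_def)
  next
    case 3
    then obtain W where sub: "VectorSpace.subspace class_ring W (module_vec TYPE(real) N)"
      and invW: "\<And>g w. g \<in> carrier G \<Longrightarrow> w \<in> W \<Longrightarrow> \<sigma> g *\<^sub>v w \<in> W"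
      and W: "W \<noteq> {0\<^sub>v N}" "W \<noteq> carrier_vec N"
      using orthogonal_rep_real_rep[OF \<sigma>] unfolding irreducible_rep_def by blast
    obtain k B where iso: "isometry_mat N k B"
      and BW: "\<And>w. w \<in> W \<Longrightarrow> (B * transpose_mat B) *\<^sub>v w = w"
      and WB: "\<And>v. v \<in> carrier_vec k \<Longrightarrow> B *\<^sub>v v \<in> W"
      using orthonormal_basis_exists[of W N] sub unfolding real_subspace_iff by blast
    obtain k' C where isoC: "isometry_mat N k' C"
      and BC: "B * transpose_mat B + C * transpose_mat C = 1\<^sub>m N" and kk': "k + k' = N"
      using isometry_complement[OF iso] by blast
    define P where "P = B * transpose_mat B"
    define R where "R = C * transpose_mat C"
    have B: "B \<in> carrier_mat N k" "transpose_mat B \<in> carrier_mat k N" and P: "P \<in> carrier_mat N N"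
      using iso by (auto simp: isometry_mat_def P_def)
    have C: "C \<in> carrier_mat N k'" "transpose_mat C \<in> carrier_mat k' N" and R: "R \<in> carrier_mat N N"
      using isoC by (auto simp: isometry_mat_def R_def)
    have symP: "transpose_mat P = P" using B by (simp add: P_def transpose_mult[OF B(1,2)])
    have PW: "P *\<^sub>v v \<in> W" if "v \<in> carrier_vec N" for v
      unfolding P_def assoc_mult_mat_vec[OF B that] using WB B that by auto
    have Wc: "W \<subseteq> carrier_vec N" using sub by (simp add: real_subspace_iff)
    have "P * (\<sigma> g * P) = \<sigma> g * P" if g: "g \<in> carrier G" for g
    proof (rule mat_eq_by_action[of _ N N])
      fix v :: "real vec" assume v: "v \<in> carrier_vec N"
      have "\<sigma> g *\<^sub>v (P *\<^sub>v v) \<in> W" using invW[OF g PW[OF v]] .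
      then show "(P * (\<sigma> g * P)) *\<^sub>v v = (\<sigma> g * P) *\<^sub>v v"
        using BW s[OF g] P v assoc_mult_mat_vec[OF P mult_carrier_mat[OF s[OF g] P] v]
          assoc_mult_mat_vec[OF s[OF g] P v] by (simp add: P_def)
    qed (use s[OF g] P in auto)
    then have commP: "P * \<sigma> g = \<sigma> g * P" if "g \<in> carrier G" for g
      using invariant_projection_commutes[OF G \<sigma> that P symP] by blast
    have commR: "R * \<sigma> g = \<sigma> g * R" if g: "g \<in> carrier G" for g
    proof -
      have PR: "P + R = 1\<^sub>m N" using BC by (simp add: P_def R_def)
      have "P * \<sigma> g + R * \<sigma> g = (P + R) * \<sigma> g"
        by (rule add_mult_distrib_mat[OF P R s[OF g], symmetric])
      also have "\<dots> = \<sigma> g * (P + R)" using s[OF g] by (simp add: PR)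
      also have "\<dots> = P * \<sigma> g + \<sigma> g * R"
        using mult_add_distrib_mat[OF s[OF g] P R] commP[OF g] by simp
      finally have eq: "P * \<sigma> g + R * \<sigma> g = P * \<sigma> g + \<sigma> g * R" .
      have c: "P * \<sigma> g \<in> carrier_mat N N" "R * \<sigma> g \<in> carrier_mat N N" "\<sigma> g * R \<in> carrier_mat N N"
        using P R s[OF g] by auto
      show ?thesis
      proof (rule eq_matI)
        fix i j assume "i < dim_row (\<sigma> g * R)" "j < dim_col (\<sigma> g * R)"
        then have ij: "i < N" "j < N" using c(3) by auto
        show "(R * \<sigma> g) $$ (i,j) = (\<sigma> g * R) $$ (i,j)"
          using arg_cong[OF eq, of "\<lambda>M. M $$ (i,j)"] ij carrier_matD[OF c(2)] carrier_matD[OF c(3)]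
            index_add_mat(1)[of i "R * \<sigma> g" j "P * \<sigma> g"] index_add_mat(1)[of i "\<sigma> g * R" j "P * \<sigma> g"]
          by (simp only: add_left_cancel)
      qed (use s[OF g] R in auto)
    qed
    \<comment> \<open>Both dimensions drop, since \<open>W\<close> is neither zero nor the whole space.\<close>
    have "k' \<noteq> 0"
    proof
      assume "k' = 0"
      then have "R = 0\<^sub>m N N" using C by (intro eq_matI) (auto simp: R_def scalar_prod_def)
      then have "P = 1\<^sub>m N" using BC P by (simp add: R_def P_def)
      then have "carrier_vec N \<subseteq> W" using PW by fastforce
      then show False using W Wc by blast
    qed
    moreover have "k \<noteq> 0"
    proof
      assume "k = 0"
      then have "P = 0\<^sub>m N N" using B by (intro eq_matI) (auto simp: P_def scalar_prod_def)
      moreover have "0\<^sub>m N N *\<^sub>v w = 0\<^sub>v N" if "w \<in> W" for w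
        using that Wc by (intro eq_vecI) auto
      ultimately have "w = 0\<^sub>v N" if "w \<in> W" for w
        using BW[OF that] that unfolding P_def by metis
      then show False using W sub by (auto simp: real_subspace_iff)
    qed
    ultimately have "k < N" "k' < N" using kk' by auto
    note cB = orthogonal_rep_compress[OF \<sigma> iso commP[unfolded P_def]]
      and cC = orthogonal_rep_compress[OF \<sigma> isoC commR[unfolded R_def]]
    obtain ts where ts: "parseval_frame G h d \<rho> k (\<lambda>g. transpose_mat B * \<sigma> g * B) ts"
      using less.IH[OF \<open>k < N\<close> cB(1)] by blast
    obtain us where us: "parseval_frame G h d \<rho> k' (\<lambda>g. transpose_mat C * \<sigma> g * C) us"
      using less.IH[OF \<open>k' < N\<close> cC(1)] by blast
    let ?tsB = "map (\<lambda>(i,T). (i, T * transpose_mat B)) ts"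
    have pB: "\<forall>(i,T)\<in>set ?tsB. i < h \<and> T \<in> carrier_mat (d i) N \<and>
        (\<forall>g\<in>carrier G. T * \<sigma> g = \<rho> i g * T)"
      by (rule parseval_frame_pullback(1)[OF ts _ _ B(1)]) (use rc s cB(2) in blast)+
    have qB: "(\<Sum>(i,T)\<leftarrow>?tsB. (transpose_mat T * T) $$ (a,b)) = (B * transpose_mat B) $$ (a,b)"
      if "a < N" "b < N" for a b
      by (rule parseval_frame_pullback(2)[OF ts _ _ B(1)]) (use rc s cB(2) that in blast)+
    let ?usC = "map (\<lambda>(i,T). (i, T * transpose_mat C)) us"
    have pC: "\<forall>(i,T)\<in>set ?usC. i < h \<and> T \<in> carrier_mat (d i) N \<and>
        (\<forall>g\<in>carrier G. T * \<sigma> g = \<rho> i g * T)"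
      by (rule parseval_frame_pullback(1)[OF us _ _ C(1)]) (use rc s cC(2) in blast)+
    have qC: "(\<Sum>(i,T)\<leftarrow>?usC. (transpose_mat T * T) $$ (a,b)) = (C * transpose_mat C) $$ (a,b)"
      if "a < N" "b < N" for a b
      by (rule parseval_frame_pullback(2)[OF us _ _ C(1)]) (use rc s cC(2) that in blast)+
    have PR: "P $$ (a,b) + R $$ (a,b) = 1\<^sub>m N $$ (a,b)" if "a < N" "b < N" for a b
      using arg_cong[OF BC, of "\<lambda>M. M $$ (a,b)"] carrier_matD[OF R] that
        index_add_mat(1)[of a R b P] by (simp only: P_def R_def)
    define vs where "vs = ?tsB @ ?usC"
    have "(\<Sum>(i,T)\<leftarrow>vs. (transpose_mat T * T) $$ (a,b)) = 1\<^sub>m N $$ (a,b)" if "a < N" "b < N" for a b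
      using qB[OF that] qC[OF that] PR[OF that]
      by (simp only: vs_def map_append sum_list_append P_def R_def)
    then have "parseval_frame G h d \<rho> N \<sigma> vs"
      using pB pC unfolding parseval_frame_def vs_def set_append ball_Un by blast
    then show ?thesis ..
  qed
qed

section \<open>Invariant sums of squares and equivariants\<close>

text \<open>
  Both the invariance of scalar products of equivariants (\<open>T\<^sup>T * T = 1\<close>) and the norm identity for a
  Parseval frame (\<open>\<Sum> T\<^sup>T * T = 1\<close>) are read off from this expansion.
\<close>

lemma const_mat_scalar_prod:
  fixes u w :: "'v rpoly vec"
  assumes T: "T \<in> carrier_mat m N" and u: "u \<in> carrier_vec N" and w: "w \<in> carrier_vec N"
  shows "(map_mat const_poly T *\<^sub>v u) \<bullet> (map_mat const_poly T *\<^sub>v w)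
      = (\<Sum>a<N. \<Sum>c<N. u $ a * w $ c * const_poly ((transpose_mat T * T) $$ (a,c)))"
proof -
  let ?M = "map_mat const_poly T :: 'v rpoly mat"
  have M: "?M \<in> carrier_mat m N" "transpose_mat ?M \<in> carrier_mat N m" using T by auto
  have MM: "transpose_mat ?M * ?M = map_mat const_poly (transpose_mat T * T)"
    using T by (subst const_poly.mat_hom_mult[of _ N m _ N]) (auto simp: map_mat_transpose)
  have "(?M *\<^sub>v u) \<bullet> (?M *\<^sub>v w) = u \<bullet> (transpose_mat ?M *\<^sub>v (?M *\<^sub>v w))"
    using transpose_vec_mult_scalar[OF M(2) , of "?M *\<^sub>v w" u] M u w by auto
  also have "\<dots> = u \<bullet> (map_mat const_poly (transpose_mat T * T) *\<^sub>v w)"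
    by (simp only: assoc_mult_mat_vec[OF M(2,1) w, symmetric] MM)
  also have "\<dots> = (\<Sum>a<N. \<Sum>c<N. u $ a * w $ c * const_poly ((transpose_mat T * T) $$ (a,c)))"
    using T u w by (simp add: scalar_prod_def[of u] scalar_prod_def[of _ w] lessThan_atLeast0
        sum_distrib_left mult_ac)
  finally show ?thesis .
qed

lemma equivariantsD:
  assumes "b \<in> equivariants G n \<phi> d \<rho>"
  shows "b \<in> carrier_vec d" "\<And>a. a < d \<Longrightarrow> b $ a \<in> polys_in {..<n}"
    "\<And>g. g \<in> carrier G \<Longrightarrow> map_vec (lin_subst (\<phi> g)) b = map_mat const_poly (\<rho> g) *\<^sub>v b"
  using assms by (auto simp: equivariants_def)

lemma equivariants_scalar_prod_invariant:
  assumes rep: "orthogonal_rep G d \<rho>"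
    and u: "u \<in> equivariants G n \<phi> d \<rho>" and w: "w \<in> equivariants G n \<phi> d \<rho>"
  shows "u \<bullet> w \<in> invariants G n \<phi>"
proof -
  note uD = equivariantsD[OF u] and wD = equivariantsD[OF w]
  have uw: "u \<bullet> w = (\<Sum>a<d. u $ a * w $ a)" using wD(1) by (simp add: scalar_prod_def lessThan_atLeast0)
  have "lin_subst (\<phi> g) (u \<bullet> w) = u \<bullet> w" if g: "g \<in> carrier G" for g
  proof -
    have \<rho>: "\<rho> g \<in> carrier_mat d d" "transpose_mat (\<rho> g) * \<rho> g = 1\<^sub>m d"
      using rep g by (auto simp: orthogonal_rep_def)
    have "lin_subst (\<phi> g) (u \<bullet> w) = map_vec (lin_subst (\<phi> g)) u \<bullet> map_vec (lin_subst (\<phi> g)) w"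
      unfolding uw using uD(1) wD(1)
      by (simp add: lin_subst_def poly_subst.hom_sum poly_subst_mult scalar_prod_def lessThan_atLeast0)
    also have "\<dots> = (\<Sum>a<d. \<Sum>c<d. u $ a * w $ c * const_poly ((transpose_mat (\<rho> g) * \<rho> g) $$ (a,c)))"
      unfolding uD(3)[OF g] wD(3)[OF g] by (rule const_mat_scalar_prod[OF \<rho>(1) uD(1) wD(1)])
    also have "\<dots> = (\<Sum>a<d. \<Sum>c<d. if a = c then u $ a * w $ c else 0)"
      unfolding \<rho>(2) by (intro sum.cong refl) (auto simp: const_poly_hom)
    also have "\<dots> = u \<bullet> w" unfolding uw by simp
    finally show ?thesis .
  qed
  moreover have "u \<bullet> w \<in> polys_in {..<n}"
    unfolding uw using uD(2) wD(2) by (intro polys_in_sum polys_in_mult) auto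
  ultimately show ?thesis by (auto simp: invariants_def)
qed

lemma intertwiner_equivariant:
  assumes T: "T \<in> carrier_mat d N" and \<rho>: "\<And>g. g \<in> carrier G \<Longrightarrow> \<rho> g \<in> carrier_mat d d"
    and \<sigma>: "\<And>g. g \<in> carrier G \<Longrightarrow> \<sigma> g \<in> carrier_mat N N"
    and int: "\<And>g. g \<in> carrier G \<Longrightarrow> T * \<sigma> g = \<rho> g * T"
    and u: "u \<in> equivariants G n \<phi> N \<sigma>"
  shows "map_mat const_poly T *\<^sub>v u \<in> equivariants G n \<phi> d \<rho>"
proof -
  note uD = equivariantsD[OF u]
  let ?M = "map_mat const_poly T :: nat rpoly mat"
  have M: "?M \<in> carrier_mat d N" using T by simp
  have comp: "(?M *\<^sub>v u) $ a = (\<Sum>c<N. const_poly (T $$ (a,c)) * u $ c)" if "a < d" for a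
    using that T uD(1) by (simp add: scalar_prod_def lessThan_atLeast0)
  have "map_vec (lin_subst (\<phi> g)) (?M *\<^sub>v u) = map_mat const_poly (\<rho> g) *\<^sub>v (?M *\<^sub>v u)"
    if g: "g \<in> carrier G" for g
  proof -
    let ?S = "map_mat const_poly (\<sigma> g) :: nat rpoly mat" and ?R = "map_mat const_poly (\<rho> g) :: nat rpoly mat"
    have S: "?S \<in> carrier_mat N N" and R: "?R \<in> carrier_mat d d" using \<sigma>[OF g] \<rho>[OF g] by auto
    have "map_vec (lin_subst (\<phi> g)) (?M *\<^sub>v u) = map_mat (lin_subst (\<phi> g)) ?M *\<^sub>v map_vec (lin_subst (\<phi> g)) u"
      unfolding lin_subst_def by (rule poly_subst.mult_mat_vec_hom[OF M uD(1)])
    also have "map_mat (lin_subst (\<phi> g)) ?M = ?M" by (intro eq_matI) (auto simp: lin_subst_def)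
    also have "map_vec (lin_subst (\<phi> g)) u = ?S *\<^sub>v u" by (rule uD(3)[OF g])
    also have "?M *\<^sub>v (?S *\<^sub>v u) = (?M * ?S) *\<^sub>v u" by (rule assoc_mult_mat_vec[OF M S uD(1), symmetric])
    also have "?M * ?S = ?R * ?M"
      using int[OF g] const_poly.mat_hom_mult[OF T \<sigma>[OF g]] const_poly.mat_hom_mult[OF \<rho>[OF g] T] by metis
    also have "(?R * ?M) *\<^sub>v u = ?R *\<^sub>v (?M *\<^sub>v u)" by (rule assoc_mult_mat_vec[OF R M uD(1)])
    finally show ?thesis .
  qed
  moreover have "(?M *\<^sub>v u) $ a \<in> polys_in {..<n}" if "a < d" for a
    unfolding comp[OF that] using uD(2) by (intro polys_in_sum polys_in_mult) auto
  ultimately show ?thesis using M uD(1) by (auto simp: equivariants_def)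
qed

lemma parseval_frame_scalar_prod:
  assumes fr: "parseval_frame G h d \<rho> N \<sigma> ts" and u: "u \<in> carrier_vec N"
  shows "u \<bullet> u = (\<Sum>(i,T)\<leftarrow>ts. (map_mat const_poly T *\<^sub>v u) \<bullet> (map_mat const_poly T *\<^sub>v (u :: 'v rpoly vec)))"
proof -
  have T: "T \<in> carrier_mat (d i) N" if "(i,T) \<in> set ts" for i T
    using fr that unfolding parseval_frame_def by fast
  have "(\<Sum>(i,T)\<leftarrow>ts. (map_mat const_poly T *\<^sub>v u) \<bullet> (map_mat const_poly T *\<^sub>v u))
      = (\<Sum>x\<leftarrow>ts. \<Sum>a<N. \<Sum>c<N. u $ a * u $ c * const_poly ((transpose_mat (snd x) * snd x) $$ (a,c)))"
    using const_mat_scalar_prod[OF T u u] by (intro arg_cong[of _ _ sum_list] map_cong refl) auto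
  also have "\<dots> = (\<Sum>a<N. \<Sum>c<N. u $ a * u $ c *
      (\<Sum>x\<leftarrow>ts. const_poly ((transpose_mat (snd x) * snd x) $$ (a,c))))"
    by (rule sum_list_weighted_swap)
  also have "\<dots> = (\<Sum>a<N. \<Sum>c<N. u $ a * u $ c * const_poly (1\<^sub>m N $$ (a,c)))"
  proof (intro sum.cong refl)
    fix a c assume "a \<in> {..<N}" "c \<in> {..<N}"
    then have "(\<Sum>x\<leftarrow>ts. (transpose_mat (snd x) * snd x) $$ (a,c)) = 1\<^sub>m N $$ (a,c)"
      using fr by (simp add: parseval_frame_def case_prod_unfold)
    then show "u $ a * u $ c * (\<Sum>x\<leftarrow>ts. const_poly ((transpose_mat (snd x) * snd x) $$ (a,c)))
        = u $ a * u $ c * const_poly (1\<^sub>m N $$ (a,c))"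
      by (simp only: flip: const_poly_sum_list)
  qed
  also have "\<dots> = (\<Sum>a<N. \<Sum>c<N. if a = c then u $ a * u $ c else 0)"
    by (intro sum.cong refl) (auto simp: const_poly_hom)
  also have "\<dots> = u \<bullet> u" using u by (simp add: scalar_prod_def lessThan_atLeast0)
  finally show ?thesis by simp
qed

text \<open>
  The function \<open>g \<mapsto> q \<circ> \<phi> g\<close>. Vectors being indexed by numbers, an enumeration \<open>e\<close> of the group has to be
  chosen.
\<close>

definition orbit_vec :: "(nat \<Rightarrow> 'g) \<Rightarrow> nat \<Rightarrow> ('g \<Rightarrow> real mat) \<Rightarrow> nat rpoly \<Rightarrow> nat rpoly vec" where
  "orbit_vec e N \<phi> q = vec N (\<lambda>a. lin_subst (\<phi> (e a)) q)"

text \<open>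
  The permutation matrix of right multiplication by \<open>g\<close>. Right multiplication is what turns up because
  \<open>lin_subst (\<phi> g) (lin_subst (\<phi> a) q)\<close> is the translate by the product \<open>a g\<close>.
\<close>

definition regular_rep :: "('g, 'b) monoid_scheme \<Rightarrow> (nat \<Rightarrow> 'g) \<Rightarrow> nat \<Rightarrow> 'g \<Rightarrow> real mat" where
  "regular_rep G e N g = mat N N (\<lambda>(a,c). if e c = e a \<otimes>\<^bsub>G\<^esub> g then 1 else 0)"

lemma orthogonal_regular_rep:
  assumes G: "group G" and e: "bij_betw e {..<N} (carrier G)"
  shows "orthogonal_rep G N (regular_rep G e N)"
proof -
  interpret group G by fact
  have eG: "e a \<in> carrier G" if "a < N" for a using e that by (auto simp: bij_betw_def)
  have einj: "e a = e b \<longleftrightarrow> a = b" if "a < N" "b < N" for a b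
    using e that by (auto simp: bij_betw_def inj_on_def)
  have esurj: "\<exists>b<N. e b = x" if "x \<in> carrier G" for x
    using e that by (metis bij_betw_iff_bijections lessThan_iff)
  show ?thesis unfolding orthogonal_rep_def
  proof (intro conjI ballI)
    fix g assume g: "g \<in> carrier G"
    show "regular_rep G e N g \<in> carrier_mat N N" by (simp add: regular_rep_def)
    show "transpose_mat (regular_rep G e N g) * regular_rep G e N g = 1\<^sub>m N"
    proof (rule eq_matI)
      fix a c assume "a < dim_row (1\<^sub>m N :: real mat)" "c < dim_col (1\<^sub>m N :: real mat)"
      then have ac: "a < N" "c < N" by auto
      obtain b where b: "b < N" "e b = e a \<otimes>\<^bsub>G\<^esub> inv\<^bsub>G\<^esub> g" using esurj[of "e a \<otimes>\<^bsub>G\<^esub> inv\<^bsub>G\<^esub> g"] eG ac g by auto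
      have iff: "e a = e j \<otimes>\<^bsub>G\<^esub> g \<longleftrightarrow> j = b" if "j < N" for j
        using that b g eG ac einj[of j b] by (metis inv_solve_right)
      have "(transpose_mat (regular_rep G e N g) * regular_rep G e N g) $$ (a,c)
          = (\<Sum>j<N. (if e a = e j \<otimes>\<^bsub>G\<^esub> g then 1 else 0) * (if e c = e j \<otimes>\<^bsub>G\<^esub> g then 1 else 0))"
        using ac by (simp add: regular_rep_def scalar_prod_def lessThan_atLeast0)
      also have "\<dots> = (\<Sum>j<N. if j = b then (if e c = e j \<otimes>\<^bsub>G\<^esub> g then 1 else 0) else 0)"
        using iff by (intro sum.cong) auto
      also have "\<dots> = (if e c = e b \<otimes>\<^bsub>G\<^esub> g then 1 else 0)" using b by simp
      also have "e b \<otimes>\<^bsub>G\<^esub> g = e a" using iff[OF b(1)] by simp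
      finally show "(transpose_mat (regular_rep G e N g) * regular_rep G e N g) $$ (a,c) = 1\<^sub>m N $$ (a,c)"
        using ac einj[of c a] by auto
    qed (auto simp: regular_rep_def)
  next
    fix g g' assume g: "g \<in> carrier G" and g': "g' \<in> carrier G"
    show "regular_rep G e N (g \<otimes>\<^bsub>G\<^esub> g') = regular_rep G e N g * regular_rep G e N g'"
    proof (rule eq_matI)
      fix a c assume "a < dim_row (regular_rep G e N g * regular_rep G e N g')"
        "c < dim_col (regular_rep G e N g * regular_rep G e N g')"
      then have ac: "a < N" "c < N" by (auto simp: regular_rep_def)
      obtain b where b: "b < N" "e b = e a \<otimes>\<^bsub>G\<^esub> g" using esurj[of "e a \<otimes>\<^bsub>G\<^esub> g"] eG ac g by auto
      have "(regular_rep G e N g * regular_rep G e N g') $$ (a,c)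
          = (\<Sum>j<N. (if e j = e a \<otimes>\<^bsub>G\<^esub> g then 1 else 0) * (if e c = e j \<otimes>\<^bsub>G\<^esub> g' then 1 else 0))"
        using ac by (simp add: regular_rep_def scalar_prod_def lessThan_atLeast0)
      also have "\<dots> = (\<Sum>j<N. if j = b then (if e c = e j \<otimes>\<^bsub>G\<^esub> g' then 1 else 0) else 0)"
        using b einj by (intro sum.cong) (auto simp flip: b(2))
      also have "\<dots> = regular_rep G e N (g \<otimes>\<^bsub>G\<^esub> g') $$ (a,c)"
        using b ac eG g g' by (simp add: regular_rep_def m_assoc)
      finally show "regular_rep G e N (g \<otimes>\<^bsub>G\<^esub> g') $$ (a,c) = (regular_rep G e N g * regular_rep G e N g') $$ (a,c)"
        by simp
    qed (auto simp: regular_rep_def)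
  qed
qed

lemma orbit_vec_equivariant:
  assumes G: "group G" and e: "bij_betw e {..<N} (carrier G)" and \<phi>: "real_rep G n \<phi>"
    and q: "q \<in> polys_in {..<n}"
  shows "orbit_vec e N \<phi> q \<in> equivariants G n \<phi> N (regular_rep G e N)"
proof -
  interpret group G by fact
  have eG: "e a \<in> carrier G" if "a < N" for a using e that by (auto simp: bij_betw_def)
  have "map_vec (lin_subst (\<phi> g)) (orbit_vec e N \<phi> q)
      = map_mat const_poly (regular_rep G e N g) *\<^sub>v orbit_vec e N \<phi> q" if g: "g \<in> carrier G" for g
  proof (rule eq_vecI)
    fix a assume "a < dim_vec (map_mat const_poly (regular_rep G e N g) *\<^sub>v orbit_vec e N \<phi> q)"
    then have a: "a < N" by (simp add: regular_rep_def)
    obtain b where b: "b < N" "e b = e a \<otimes>\<^bsub>G\<^esub> g"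
      using e eG[OF a] g by (metis bij_betw_iff_bijections lessThan_iff m_closed)
    have ebc: "e c = e b \<longleftrightarrow> c = b" if "c < N" for c
      using e that b(1) by (auto simp: bij_betw_def inj_on_def)
    have "(map_mat const_poly (regular_rep G e N g) *\<^sub>v orbit_vec e N \<phi> q) $ a
        = (\<Sum>c<N. const_poly (if e c = e b then 1 else 0) * lin_subst (\<phi> (e c)) q)"
      using a by (simp add: regular_rep_def orbit_vec_def scalar_prod_def lessThan_atLeast0 b(2))
    also have "\<dots> = (\<Sum>c<N. if c = b then lin_subst (\<phi> (e c)) q else 0)"
      using ebc by (intro sum.cong) (auto simp: const_poly_hom)
    also have "\<dots> = lin_subst (\<phi> (e a) * \<phi> g) q"
      using b real_rep_mult[OF \<phi> eG[OF a] g] by simp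
    also have "\<dots> = lin_subst (\<phi> g) (lin_subst (\<phi> (e a)) q)"
      using lin_subst_lin_subst[OF q] real_rep_carrier[OF \<phi>] eG[OF a] g by simp
    finally show "map_vec (lin_subst (\<phi> g)) (orbit_vec e N \<phi> q) $ a
        = (map_mat const_poly (regular_rep G e N g) *\<^sub>v orbit_vec e N \<phi> q) $ a"
      using a by (simp add: orbit_vec_def)
  qed (simp add: regular_rep_def orbit_vec_def)
  then show ?thesis
    using lin_subst_polys_in[OF q real_rep_carrier[OF \<phi> eG]] by (auto simp: equivariants_def orbit_vec_def)
qed

text \<open>
  For \<open>f = \<Sum> q\<^sup>2\<close> invariant, averaging over the group gives
  \<open>f = 1/|G| * \<Sum>\<^sub>q \<Sum>\<^sub>g (q \<circ> \<phi> g)\<^sup>2\<close>, a sum of squared norms of the equivariants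
  \<open>orbit_vec e N \<phi> q\<close> of the regular representation. A Parseval frame splits each of these squared norms
  into squared norms of equivariants of the \<open>\<rho> i\<close>.
\<close>

lemma invariant_sos_as_equivariant_norms:
  assumes G: "group G" and fin: "finite (carrier G)" and \<phi>: "real_rep G n \<phi>"
    and irr: "orthogonal_irreps G h d \<rho>"
    and sos: "sos_in {..<n} f" and inv: "f \<in> invariants G n \<phi>"
  obtains us where "\<And>i u. (i,u) \<in> set us \<Longrightarrow> i < h \<and> u \<in> equivariants G n \<phi> (d i) (\<rho> i)"
    "f = (\<Sum>(i,u)\<leftarrow>us. u \<bullet> u)"
proof -
  interpret group G by fact
  obtain qs where qs: "set qs \<subseteq> polys_in {..<n}" and f: "f = (\<Sum>q\<leftarrow>qs. q ^ 2)"
    using sos by (auto simp: sos_in_def)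
  define N where "N = card (carrier G)"
  have N: "N > 0" unfolding N_def using fin one_closed by (auto simp: card_gt_0_iff)
  obtain e where e: "bij_betw e {..<N} (carrier G)"
    using ex_bij_betw_nat_finite[OF fin] by (auto simp: N_def lessThan_atLeast0)
  let ?\<sigma> = "regular_rep G e N"
  have \<sigma>: "orthogonal_rep G N ?\<sigma>" by (rule orthogonal_regular_rep[OF G e])
  obtain ts where ts: "parseval_frame G h d \<rho> N ?\<sigma> ts" using parseval_frame_exists[OF G irr \<sigma>] by blast
  \<comment> \<open>The factor \<open>1/|G|\<close> of the average, moved inside the squares.\<close>
  define s where "s = (const_poly (1 / sqrt (real N)) :: nat rpoly)"
  define Q where "Q q = orbit_vec e N \<phi> (s * q)" for q
  define us where "us = concat (map (\<lambda>q. map (\<lambda>(i,T). (i, map_mat const_poly T *\<^sub>v Q q)) ts) qs)"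
  have Q: "Q q \<in> equivariants G n \<phi> N ?\<sigma>" if "q \<in> set qs" for q
    unfolding Q_def using that qs
    by (intro orbit_vec_equivariant[OF G e \<phi>] polys_in_mult) (auto simp: s_def)
  have "i < h \<and> u \<in> equivariants G n \<phi> (d i) (\<rho> i)" if iu: "(i,u) \<in> set us" for i u
  proof -
    obtain q T where q: "q \<in> set qs" and T: "(i,T) \<in> set ts" and u: "u = map_mat const_poly T *\<^sub>v Q q"
      using iu by (auto simp: us_def)
    have i: "i < h" "T \<in> carrier_mat (d i) N" "\<And>g. g \<in> carrier G \<Longrightarrow> T * ?\<sigma> g = \<rho> i g * T"
      using ts T unfolding parseval_frame_def by fast+
    show ?thesis unfolding u using i(1) orthogonal_irreps_rep[OF irr i(1)] \<sigma>
      by (auto intro!: intertwiner_equivariant[OF i(2) _ _ i(3) Q[OF q]] simp: orthogonal_rep_def)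
  qed
  moreover have "f = (\<Sum>(i,u)\<leftarrow>us. u \<bullet> u)"
  proof -
    have QQ: "Q q \<bullet> Q q = (\<Sum>a<N. s ^ 2 * lin_subst (\<phi> (e a)) (q ^ 2))" for q
      unfolding Q_def by (simp add: orbit_vec_def scalar_prod_def lessThan_atLeast0 lin_subst_def
          poly_subst_mult poly_subst.hom_power s_def power2_eq_square mult_ac)
    have fe: "lin_subst (\<phi> (e a)) f = f" if "a < N" for a
    proof -
      have "e a \<in> carrier G" using e that by (auto simp: bij_betw_def)
      then show ?thesis using inv unfolding invariants_def by (intro sym[of f]) blast
    qed
    have s2: "of_nat N * s ^ 2 = 1"
    proof -
      have "of_nat N = (const_poly (real N) :: nat rpoly)" by (simp add: const_poly_def)
      then have "of_nat N * s ^ 2 = const_poly (real N * (1 / sqrt (real N)) ^ 2)"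
        by (simp only: s_def const_poly.hom_mult const_poly.hom_power)
      also have "real N * (1 / sqrt (real N)) ^ 2 = 1" using N by (simp add: power2_eq_square)
      finally show ?thesis by (simp add: const_poly_hom)
    qed
    have "(\<Sum>(i,u)\<leftarrow>us. u \<bullet> u) = (\<Sum>q\<leftarrow>qs. \<Sum>(i,T)\<leftarrow>ts. (map_mat const_poly T *\<^sub>v Q q) \<bullet> (map_mat const_poly T *\<^sub>v Q q))"
      unfolding us_def by (induction qs) (simp_all add: case_prod_unfold o_def)
    also have "\<dots> = (\<Sum>q\<leftarrow>qs. Q q \<bullet> Q q)"
      by (intro arg_cong[of _ _ sum_list] map_cong refl parseval_frame_scalar_prod[OF ts, symmetric]
          equivariantsD(1)[OF Q])
    also have "\<dots> = (\<Sum>q\<leftarrow>qs. \<Sum>a<N. s ^ 2 * lin_subst (\<phi> (e a)) (q ^ 2))" by (simp only: QQ)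
    also have "\<dots> = (\<Sum>a<N. s ^ 2 * lin_subst (\<phi> (e a)) f)"
      unfolding f by (induction qs) (auto simp: lin_subst_def poly_subst_add distrib_left sum.distrib)
    also have "\<dots> = f" using fe s2 by (simp flip: mult.assoc)
    finally show ?thesis by simp
  qed
  ultimately show thesis using that by blast
qed

section \<open>Representation by primary and secondary invariants\<close>

text \<open>
  The description that determines \<open>inv_representation\<close>: \<open>R\<close> is linear in the \<open>\<eta>\<^sub>j\<close> and becomes \<open>p\<close> when the
  invariants are substituted. As a relation it is visibly compatible with sums and with multiplication
  by polynomials in the \<open>\<theta>\<^sub>i\<close>, which the definite description is not.
\<close>

definition represents ::
  "nat \<Rightarrow> (nat \<Rightarrow> nat rpoly) \<Rightarrow> nat \<Rightarrow> (nat \<Rightarrow> nat rpoly) \<Rightarrow> nat rpoly \<Rightarrow> (nat + nat) rpoly \<Rightarrow> bool"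
  where
  "represents n \<theta> t \<eta> p R \<longleftrightarrow>
     (\<exists>c. (\<forall>j<t. c j \<in> polys_in {..<n}) \<and> R = (\<Sum>j<t. var_poly (Inr j) * incl_poly (c j))) \<and>
     p = poly_subst (case_sum \<theta> \<eta>) R"

lemma poly_subst_incl [simp]: "poly_subst (case_sum \<theta> \<eta>) (incl_poly p) = poly_subst \<theta> p"
  by (simp add: incl_poly_def poly_subst_subst)

lemma poly_subst_eta_linear:
  "poly_subst (case_sum \<theta> \<eta>) (\<Sum>j<t. var_poly (Inr j) * incl_poly (c j)) = (\<Sum>j<t. \<eta> j * poly_subst \<theta> (c j))"
  by (simp add: poly_subst.hom_sum poly_subst_mult)

lemma represents_0: "represents n \<theta> t \<eta> 0 0"
  unfolding represents_def by (auto simp: incl_poly_def intro!: exI[of _ "\<lambda>_. 0"])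

lemma represents_add:
  assumes "represents n \<theta> t \<eta> p R" "represents n \<theta> t \<eta> q S"
  shows "represents n \<theta> t \<eta> (p + q) (R + S)"
proof -
  obtain c c' where c: "\<forall>j<t. c j \<in> polys_in {..<n}" "R = (\<Sum>j<t. var_poly (Inr j) * incl_poly (c j))"
    and c': "\<forall>j<t. c' j \<in> polys_in {..<n}" "S = (\<Sum>j<t. var_poly (Inr j) * incl_poly (c' j))"
    using assms by (auto simp: represents_def)
  have "R + S = (\<Sum>j<t. var_poly (Inr j) * incl_poly (c j + c' j))"
    by (simp add: c(2) c'(2) incl_poly_def poly_subst_add distrib_left sum.distrib)
  moreover have "\<forall>j<t. c j + c' j \<in> polys_in {..<n}" using c(1) c'(1) by auto
  moreover have "p + q = poly_subst (case_sum \<theta> \<eta>) (R + S)"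
    using assms by (simp add: represents_def poly_subst_add)
  ultimately show ?thesis unfolding represents_def by (intro conjI exI[of _ "\<lambda>j. c j + c' j"])
qed

lemma represents_sum:
  assumes "\<And>x. x \<in> A \<Longrightarrow> represents n \<theta> t \<eta> (p x) (R x)"
  shows "represents n \<theta> t \<eta> (\<Sum>x\<in>A. p x) (\<Sum>x\<in>A. R x)"
  using assms by (induction A rule: infinite_finite_induct) (auto intro: represents_0 represents_add)

lemma represents_mult:
  assumes "represents n \<theta> t \<eta> p R" "s \<in> polys_in {..<n}"
  shows "represents n \<theta> t \<eta> (poly_subst \<theta> s * p) (incl_poly s * R)"
proof -
  obtain c where c: "\<forall>j<t. c j \<in> polys_in {..<n}" "R = (\<Sum>j<t. var_poly (Inr j) * incl_poly (c j))"
    using assms by (auto simp: represents_def)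
  have "incl_poly s * R = (\<Sum>j<t. var_poly (Inr j) * incl_poly (s * c j))"
    by (simp add: c(2) incl_poly_def poly_subst_mult sum_distrib_left mult_ac)
  moreover have "\<forall>j<t. s * c j \<in> polys_in {..<n}" using c(1) assms(2) by auto
  moreover have "poly_subst \<theta> s * p = poly_subst (case_sum \<theta> \<eta>) (incl_poly s * R)"
    using assms by (simp add: represents_def poly_subst_mult)
  ultimately show ?thesis unfolding represents_def by (intro conjI exI[of _ "\<lambda>j. s * c j"])
qed

text \<open>
  Substituting the invariants loses nothing on polynomials that are linear in \<open>\<eta>\<close>: this is the directness
  of the Hironaka decomposition.
\<close>

lemma represents_unique:
  assumes inv: "primary_secondary_invariants G n \<phi> \<theta> t \<eta>"
    and R: "represents n \<theta> t \<eta> p R" and S: "represents n \<theta> t \<eta> p S"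
  shows "R = S"
proof -
  obtain c c' where c: "\<forall>j<t. c j \<in> polys_in {..<n}" "R = (\<Sum>j<t. var_poly (Inr j) * incl_poly (c j))"
    and c': "\<forall>j<t. c' j \<in> polys_in {..<n}" "S = (\<Sum>j<t. var_poly (Inr j) * incl_poly (c' j))"
    using R S by (auto simp: represents_def)
  have "(\<Sum>j<t. \<eta> j * poly_subst \<theta> (c j)) = (\<Sum>j<t. \<eta> j * poly_subst \<theta> (c' j))"
    using R S by (simp add: represents_def c(2) c'(2) poly_subst_eta_linear)
  then have sum: "(\<Sum>j<t. \<eta> j * poly_subst \<theta> (c j - c' j)) = 0"
    by (simp add: poly_subst.hom_minus right_diff_distrib sum_subtractf)
  have mem: "\<forall>j<t. c j - c' j \<in> polys_in {..<n}" using c(1) c'(1) by auto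
  have uniq: "\<And>c. \<lbrakk>\<forall>j<t. c j \<in> polys_in {..<n}; (\<Sum>j<t. \<eta> j * poly_subst \<theta> (c j)) = 0\<rbrakk>
      \<Longrightarrow> \<forall>j<t. c j = 0"
    using inv unfolding primary_secondary_invariants_def by (elim conjE) simp
  have "c j = c' j" if "j < t" for j using uniq[OF mem sum] that by simp
  then show ?thesis unfolding c(2) c'(2) by (intro sum.cong refl) simp
qed

lemma inv_representation_eqI:
  assumes "primary_secondary_invariants G n \<phi> \<theta> t \<eta>" "represents n \<theta> t \<eta> p R"
  shows "inv_representation n \<theta> t \<eta> p = R"
  unfolding inv_representation_def represents_def[symmetric]
  using assms represents_unique by (intro the_equality) blast+

lemma inv_representation_represents:
  assumes inv: "primary_secondary_invariants G n \<phi> \<theta> t \<eta>" and p: "p \<in> invariants G n \<phi>"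
  shows "represents n \<theta> t \<eta> p (inv_representation n \<theta> t \<eta> p)"
proof -
  obtain c where c: "\<forall>j<t. c j \<in> polys_in {..<n}" "p = (\<Sum>j<t. \<eta> j * poly_subst \<theta> (c j))"
    using inv p unfolding primary_secondary_invariants_def by blast
  have "represents n \<theta> t \<eta> p (\<Sum>j<t. var_poly (Inr j) * incl_poly (c j))"
    unfolding represents_def using c by (auto simp: poly_subst_eta_linear)
  then show ?thesis using inv_representation_eqI[OF inv] by simp
qed

section \<open>Sum of squares matrices\<close>

text \<open>
  The sum of the rank one matrices \<open>c * c\<^sup>T\<close> over the coefficient vectors \<open>c\<close> in the list.
\<close>

definition gram_mat :: "nat \<Rightarrow> (nat \<Rightarrow> nat rpoly) list \<Rightarrow> nat rpoly mat" where
  "gram_mat m cs = mat m m (\<lambda>(k,l). \<Sum>c\<leftarrow>cs. c k * c l)"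

text \<open>
  \<open>y\<^sup>T (\<Sum> c * c\<^sup>T) y = \<Sum> (\<Sum>\<^sub>k c\<^sub>k y\<^sub>k)\<^sup>2\<close>.
\<close>

lemma sos_matrix_gram:
  assumes "\<And>c k. c \<in> set cs \<Longrightarrow> k < m \<Longrightarrow> c k \<in> polys_in {..<n}"
  shows "sos_matrix n m (gram_mat m cs)"
proof -
  let ?S = "gram_mat m cs"
  define y where "y = vec m (\<lambda>k. var_poly (Inr k) :: (nat + nat) rpoly)"
  define Q where "Q c = (\<Sum>k<m. incl_poly (c k) * var_poly (Inr k) :: (nat + nat) rpoly)" for c
  have entries: "(\<Sum>c\<leftarrow>cs. c k * c l) \<in> polys_in {..<n}" if "k < m" "l < m" for k l
    by (intro polys_in_sum_list polys_in_mult assms that)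
  have S: "?S \<in> carrier_mat m m" by (simp add: gram_mat_def)
  have "y \<bullet> (map_mat incl_poly ?S *\<^sub>v y)
      = (\<Sum>k<m. \<Sum>l<m. (var_poly (Inr k) * var_poly (Inr l)) * incl_poly (\<Sum>c\<leftarrow>cs. c k * c l))"
    by (simp add: y_def gram_mat_def scalar_prod_def lessThan_atLeast0 sum_distrib_left mult_ac)
  also have "\<dots> = (\<Sum>c\<leftarrow>cs. \<Sum>k<m. \<Sum>l<m. (var_poly (Inr k) * var_poly (Inr l)) * incl_poly (c k * c l))"
    unfolding sum_list_weighted_swap by (simp add: incl_poly_def poly_subst.hom_sum_list o_def)
  also have "\<dots> = (\<Sum>c\<leftarrow>cs. Q c ^ 2)"
    by (simp add: Q_def power2_eq_square sum_product incl_poly_def poly_subst_mult mult_ac)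
  finally have "y \<bullet> (map_mat incl_poly ?S *\<^sub>v y) = (\<Sum>q\<leftarrow>map Q cs. q ^ 2)" by (simp add: o_def)
  moreover have "set (map Q cs) \<subseteq> polys_in ({..<n} <+> {..<m})"
  proof -
    have "Q c \<in> polys_in ({..<n} <+> {..<m})" if "c \<in> set cs" for c
      unfolding Q_def incl_poly_def using assms[OF that]
      by (intro polys_in_sum polys_in_mult polys_in_poly_subst[of _ "{..<n}"]) auto
    then show ?thesis by auto
  qed
  ultimately have "sos_in ({..<n} <+> {..<m}) (y \<bullet> (map_mat incl_poly ?S *\<^sub>v y))"
    unfolding sos_in_def by blast
  moreover have "transpose_mat ?S = ?S" by (intro eq_matI) (auto simp: gram_mat_def mult.commute)
  moreover have "elements_mat ?S \<subseteq> polys_in {..<n}"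
    using entries by (auto simp: elements_mat_def gram_mat_def)
  ultimately show ?thesis using S by (simp add: sos_matrix_def y_def Let_def)
qed

lemma theta_comb_scalar_prod:
  assumes b: "\<And>k. k < r \<Longrightarrow> b k \<in> carrier_vec d"
  shows "theta_comb \<theta> d r b c \<bullet> theta_comb \<theta> d r b c
      = (\<Sum>k<r. \<Sum>l<r. (b k \<bullet> b l) * poly_subst \<theta> (c k * c l))"
proof -
  have "theta_comb \<theta> d r b c \<bullet> theta_comb \<theta> d r b c
      = (\<Sum>a<d. \<Sum>k<r. \<Sum>l<r. (b k $ a * b l $ a) * poly_subst \<theta> (c k * c l))"
    by (simp add: theta_comb_def scalar_prod_def lessThan_atLeast0 sum_product poly_subst_mult mult_ac)
  also have "\<dots> = (\<Sum>k<r. \<Sum>a<d. \<Sum>l<r. (b k $ a * b l $ a) * poly_subst \<theta> (c k * c l))"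
    by (rule sum.swap)
  also have "\<dots> = (\<Sum>k<r. \<Sum>l<r. \<Sum>a<d. (b k $ a * b l $ a) * poly_subst \<theta> (c k * c l))"
    by (intro sum.cong refl sum.swap)
  also have "\<dots> = (\<Sum>k<r. \<Sum>l<r. (b k \<bullet> b l) * poly_subst \<theta> (c k * c l))"
    using carrier_vecD[OF b] by (simp add: scalar_prod_def lessThan_atLeast0 sum_distrib_right)
  finally show ?thesis .
qed

lemma sum_list_group_by_fst:
  fixes F :: "nat \<Rightarrow> 'b \<Rightarrow> 'a :: comm_monoid_add"
  assumes "\<And>x. x \<in> set xs \<Longrightarrow> fst x < h"
  shows "(\<Sum>x\<leftarrow>xs. F (fst x) (snd x)) = (\<Sum>i<h. \<Sum>c\<leftarrow>map snd (filter (\<lambda>x. fst x = i) xs). F i c)"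
  using assms
proof (induction xs)
  case (Cons x xs)
  have "(\<Sum>i<h. \<Sum>c\<leftarrow>map snd (filter (\<lambda>x. fst x = i) (x # xs)). F i c)
      = (\<Sum>i<h. (if i = fst x then F i (snd x) else 0) + (\<Sum>c\<leftarrow>map snd (filter (\<lambda>x. fst x = i) xs). F i c))"
    by (intro sum.cong) auto
  also have "\<dots> = F (fst x) (snd x) + (\<Sum>i<h. \<Sum>c\<leftarrow>map snd (filter (\<lambda>x. fst x = i) xs). F i c)"
    using Cons.prems[of x] by (simp add: sum.distrib)
  finally show ?case using Cons by simp
qed simp

theorem theorem6p2:
  fixes G :: "('g, 'b) monoid_scheme"
    and n t h :: nat
    and \<phi> :: "'g \<Rightarrow> real mat"
    and f :: "nat rpoly"
    and \<theta> \<eta> :: "nat \<Rightarrow> nat rpoly"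
    and d r :: "nat \<Rightarrow> nat"
    and \<rho> :: "nat \<Rightarrow> 'g \<Rightarrow> real mat"
    and b :: "nat \<Rightarrow> nat \<Rightarrow> nat rpoly vec"
  assumes "group G" and "finite (carrier G)"
    and "real_rep G n \<phi>"
    and "orthogonal_irreps G h d \<rho>"
    and "primary_secondary_invariants G n \<phi> \<theta> t \<eta>"
    and "\<And>i. i < h \<Longrightarrow> equivariant_basis G n \<phi> \<theta> (d i) (\<rho> i) (r i) (b i)"
    and "sos_in {..<n} f"
    and "f \<in> invariants G n \<phi>"
  shows "\<exists>S :: nat \<Rightarrow> nat rpoly mat.
           (\<forall>i<h. sos_matrix n (r i) (S i)) \<and>
           inv_representation n \<theta> t \<eta> f =
             (\<Sum>i<h. mat_inner (map_mat incl_poly (S i)) (Pi_mat n \<theta> t \<eta> (r i) (b i)))"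
proof -
  note G = assms(1) and fin = assms(2) and \<phi> = assms(3) and irr = assms(4) and inv = assms(5)
    and basis = assms(6) and sos = assms(7) and f_inv = assms(8)
  obtain us where us: "\<And>i u. (i,u) \<in> set us \<Longrightarrow> i < h \<and> u \<in> equivariants G n \<phi> (d i) (\<rho> i)"
    and f: "f = (\<Sum>(i,u)\<leftarrow>us. u \<bullet> u)"
    using invariant_sos_as_equivariant_norms[OF G fin \<phi> irr sos f_inv] by blast
  have beq: "b i k \<in> equivariants G n \<phi> (d i) (\<rho> i)" if "i < h" "k < r i" for i k
    using basis[OF that(1)] that(2) unfolding equivariant_basis_def by blast
  have "\<exists>c. (\<forall>k<r i. c k \<in> polys_in {..<n}) \<and> u = theta_comb \<theta> (d i) (r i) (b i) c"
    if "(i,u) \<in> set us" for i u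
    using us[OF that] basis[of i] unfolding equivariant_basis_def by blast
  then obtain C where C: "\<And>i u k. (i,u) \<in> set us \<Longrightarrow> k < r i \<Longrightarrow> C i u k \<in> polys_in {..<n}"
      "\<And>i u. (i,u) \<in> set us \<Longrightarrow> u = theta_comb \<theta> (d i) (r i) (b i) (C i u)"
    by metis
  define ds where "ds = map (\<lambda>(i,u). (i, C i u)) us"
  define cs where "cs i = map snd (filter (\<lambda>x. fst x = i) ds)" for i
  define S where "S i = gram_mat (r i) (cs i)" for i
  have ds: "fst x < h" if "x \<in> set ds" for x using that by (auto simp: ds_def dest: us)
  have cs: "c k \<in> polys_in {..<n}" if c: "c \<in> set (cs i)" and k: "k < r i" for i c k
  proof -
    obtain u where "(i,u) \<in> set us" "c = C i u" using c by (auto simp: cs_def ds_def)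
    then show ?thesis using C(1) k by blast
  qed
  have Sc: "S i \<in> carrier_mat (r i) (r i)" for i by (simp add: S_def gram_mat_def)
  have S_in: "S i $$ (k,l) \<in> polys_in {..<n}" if "k < r i" "l < r i" for i k l
  proof -
    have "(\<Sum>c\<leftarrow>cs i. c k * c l) \<in> polys_in {..<n}"
      by (intro polys_in_sum_list polys_in_mult cs[of _ i] that)
    then show ?thesis using that by (simp add: S_def gram_mat_def)
  qed
  \<comment> \<open>The identity to be proved, with the invariants \<open>\<theta>(x)\<close>, \<open>\<eta>(x)\<close> substituted.\<close>
  have f_eq: "f = (\<Sum>i<h. \<Sum>k<r i. \<Sum>l<r i. poly_subst \<theta> (S i $$ (k,l)) * (b i k \<bullet> b i l))"
  proof -
    define F where "F i c = (\<Sum>k<r i. \<Sum>l<r i. (b i k \<bullet> b i l) * poly_subst \<theta> (c k * c l))" for i c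
    have norm: "u \<bullet> u = F i (C i u)" if "(i,u) \<in> set us" for i u
    proof -
      let ?v = "theta_comb \<theta> (d i) (r i) (b i) (C i u)"
      have "u \<bullet> u = ?v \<bullet> ?v"
        by (intro arg_cong2[of _ _ _ _ "(\<bullet>)"] C(2) that)
      also have "\<dots> = F i (C i u)"
        unfolding F_def by (rule theta_comb_scalar_prod) (use beq us[OF that] equivariantsD(1) in blast)
      finally show ?thesis .
    qed
    have "f = (\<Sum>x\<leftarrow>ds. F (fst x) (snd x))"
      unfolding f ds_def map_map using norm by (intro arg_cong[of _ _ sum_list] map_cong refl) auto
    also have "\<dots> = (\<Sum>i<h. \<Sum>c\<leftarrow>cs i. F i c)"
      unfolding cs_def by (rule sum_list_group_by_fst[OF ds])
    also have "\<dots> = (\<Sum>i<h. \<Sum>c\<leftarrow>cs i. \<Sum>k<r i. \<Sum>l<r i. (b i k \<bullet> b i l) * poly_subst \<theta> (c k * c l))"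
      by (simp only: F_def)
    also have "\<dots> = (\<Sum>i<h. \<Sum>k<r i. \<Sum>l<r i. (b i k \<bullet> b i l) * poly_subst \<theta> (\<Sum>c\<leftarrow>cs i. c k * c l))"
      by (simp add: sum_list_weighted_swap poly_subst.hom_sum_list o_def)
    also have "\<dots> = (\<Sum>i<h. \<Sum>k<r i. \<Sum>l<r i. poly_subst \<theta> (S i $$ (k,l)) * (b i k \<bullet> b i l))"
      by (intro sum.cong refl) (auto simp: S_def gram_mat_def mult.commute)
    finally show ?thesis .
  qed
  have bb: "b i k \<bullet> b i l \<in> invariants G n \<phi>" if "i < h" "k < r i" "l < r i" for i k l
    using equivariants_scalar_prod_invariant[OF orthogonal_irreps_rep[OF irr]] beq that by blast
  have "represents n \<theta> t \<eta> f (\<Sum>i<h. \<Sum>k<r i. \<Sum>l<r i.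
      incl_poly (S i $$ (k,l)) * inv_representation n \<theta> t \<eta> (b i k \<bullet> b i l))"
    by (subst f_eq) (intro represents_sum represents_mult S_in inv_representation_represents[OF inv]
       bb; simp)
  then have "inv_representation n \<theta> t \<eta> f = (\<Sum>i<h. \<Sum>k<r i. \<Sum>l<r i.
      incl_poly (S i $$ (k,l)) * inv_representation n \<theta> t \<eta> (b i k \<bullet> b i l))"
    by (rule inv_representation_eqI[OF inv])
  also have "\<dots> = (\<Sum>i<h. mat_inner (map_mat incl_poly (S i)) (Pi_mat n \<theta> t \<eta> (r i) (b i)))"
    using carrier_matD[OF Sc] by (simp add: mat_inner_def Pi_mat_def)
  finally have "inv_representation n \<theta> t \<eta> f
      = (\<Sum>i<h. mat_inner (map_mat incl_poly (S i)) (Pi_mat n \<theta> t \<eta> (r i) (b i)))" .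
  moreover have "sos_matrix n (r i) (S i)" for i
    unfolding S_def by (rule sos_matrix_gram) (rule cs)
  ultimately show ?thesis by blast
qed

end
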